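(* Let $\Phi=\langle x,\gamma\rangle\le W$ be the Fabrykowski–Gupta group, with $x$ the rigid $3$-cycle and $\gamma=(\gamma,x,1)$. Let $U=\langle\Delta^n(x):n\ge1\rangle$, a countably infinite elementary abelian $3$-group. Then $\mathrm{Aut}(\Phi)=\Phi:U$ (a split extension).
   Context: $W$ is the isometry group of the ternary tree $X^*$, $X=\{0,1,2\}$; elements are written $(g_0,g_1,g_2)\pi$, meaning $(yw)^{(g_0,g_1,g_2)\pi}=y^\pi w^{g_y}$. $x=(1,1,1)(0\,1\,2)$. $\Delta g=(g,g,g)$ and $\Delta^n$ its iterate. $\mathrm{Aut}(\Phi)$ is realized inside $W$ as the normalizer of $\Phi$ in $W$, acting by conjugation. *)

theory Defs
  imports "HOL-Algebra.Group_Action" "HOL-Algebra.Generated_Groups" "HOL-Library.Countable_Set"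
begin

datatype tri = T0 | T1 | T2

fun cyc :: "tri \<Rightarrow> tri" where
  "cyc T0 = T1" | "cyc T1 = T2" | "cyc T2 = T0"

text \<open>W: isometries (automorphisms) of the rooted tree X^*: bijections of words
  preserving length and the prefix relation.\<close>
definition W_set :: "(tri list \<Rightarrow> tri list) set" where
  "W_set = {f. bij f \<and> (\<forall>w. length (f w) = length w) \<and>
               (\<forall>u v. take (length u) (f (u @ v)) = f u)}"

text \<open>Elements act on the right: w^(g h) = (w^g)^h, so the product g h is the
  function composition h o g.\<close>
definition W :: "(tri list \<Rightarrow> tri list) monoid" where
  "W = \<lparr>carrier = W_set, mult = (\<lambda>g h. h \<circ> g), one = id\<rparr>"

fun xx :: "tri list \<Rightarrow> tri list" where
  "xx [] = []"
| "xx (y # w) = cyc y # w"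

fun gam :: "tri list \<Rightarrow> tri list" where
  "gam [] = []"
| "gam (T0 # w) = T0 # gam w"
| "gam (T1 # w) = T1 # xx w"
| "gam (T2 # w) = T2 # w"

fun Delta :: "(tri list \<Rightarrow> tri list) \<Rightarrow> tri list \<Rightarrow> tri list" where
  "Delta g [] = []"
| "Delta g (y # w) = y # g w"

definition Phi :: "(tri list \<Rightarrow> tri list) set" where
  "Phi = generate W {xx, gam}"

definition U :: "(tri list \<Rightarrow> tri list) set" where
  "U = generate W {(Delta ^^ n) xx | n. n \<ge> 1}"

end

theory Submission
  imports Defs
begin

text \<open>
  Write \<open>\<gamma>\<^sub>i\<close> for the conjugates of \<open>\<gamma>\<close> by powers of \<open>x\<close>. Since \<open>[\<gamma>, \<gamma>\<^sup>x] = (1, [x, \<gamma>], 1)\<close>, the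
  group \<open>\<Phi>\<close> contains \<open>\<Phi>' \<times> \<Phi>' \<times> \<Phi>'\<close>, and a triple of elements of \<open>\<Phi>\<close> lies in \<open>\<Phi>\<close> iff the
  \<open>\<gamma>\<close>-exponent of each component is the \<open>x\<close>-exponent of the next one. Looking at the sections of
  \<open>\<gamma>\<^sup>g\<close> and \<open>x\<^sup>g\<close>, every \<open>g\<close> in the normalizer permutes the first level cyclically, has its sections
  in the normalizer, in a single coset of \<open>\<Phi>\<close>, and acts trivially on \<open>\<Phi>/\<Phi>'\<close>. It follows that \<open>g\<close>
  lies in \<open>\<Phi>U\<close> as soon as one of its sections does.

  For the descent, let \<open>\<ell>\<close> count the letters \<open>\<gamma>\<^sub>i\<^sup>\<plusminus>\<close> in a shortest word; the lengths of the three
  sections of an element add up to at most its length. Hence \<open>\<ell>(\<gamma>\<^sup>g) + \<ell>(x\<^sup>g)\<close> does not grow when \<open>g\<close> is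
  replaced by its section at 0 or 1. In a minimal counterexample all these inequalities
  are equalities, which leaves only words \<open>\<gamma>\<^sub>1\<^sup>a \<gamma>\<^sub>0 \<gamma>\<^sub>1\<^sup>-\<^sup>a\<close> for \<open>\<gamma>\<^sup>g\<close>; then some section of \<open>g\<close> times
  \<open>\<gamma>\<^sup>a\<close> centralizes \<open>\<Phi>\<close>, hence is trivial.
\<close>

section \<open>Tree automorphisms as an additive group\<close>

text \<open>Letters become the integers mod 3: powers of \<open>X\<close> then act by translation on
  the first level, and exponents of elements of order 3 are letters too.\<close>

instantiation tri :: ab_group_add
begin

definition zero_tri :: tri where "zero_tri = T0"
fun plus_tri :: "tri \<Rightarrow> tri \<Rightarrow> tri" where
  "T0 + b = b" | "T1 + b = cyc b" | "T2 + b = cyc (cyc b)"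
fun uminus_tri :: "tri \<Rightarrow> tri" where
  "- T0 = T0" | "- T1 = T2" | "- T2 = T1"
definition minus_tri :: "tri \<Rightarrow> tri \<Rightarrow> tri" where "minus_tri a b = a + - b"

instance
proof
  fix a b c :: tri
  show "a + b + c = a + (b + c)" by (cases a; cases b; cases c; simp)
  show "a + b = b + a" by (cases a; cases b; simp)
  show "0 + a = a" by (simp add: zero_tri_def)
  show "- a + a = 0" by (cases a; simp add: zero_tri_def)
  show "a - b = a + - b" by (rule minus_tri_def)
qed

end

lemma cyc_eq_plus: "cyc y = y + T1"
  by (cases y; simp)

lemma tri_triple [simp]: "a + a + a = (0::tri)" "a + (a + a) = (0::tri)"
  by (cases a; simp add: zero_tri_def)+

lemma tri_plus_simps [simp]: "T1 + T1 = T2" "T1 + T2 = 0" "T2 + T1 = 0" "T2 + T2 = T1"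
  and T_neq [simp]: "T1 \<noteq> 0" "T2 \<noteq> 0" "0 \<noteq> T1" "0 \<noteq> T2"
  by (simp_all add: zero_tri_def)

declare plus_tri.simps [simp del]

lemma tri_cases:
  fixes y :: tri
  obtains "y = 0" | "y = T1" | "y = T2"
  by (cases y; simp add: zero_tri_def)

text \<open>Translation by \<open>k\<close> only reorders the summands; sums over the three sections
  thus ignore rotations.\<close>

lemma tri_sum_shift: "f k + f (T1 + k) + f (T2 + k) = f 0 + f T1 + f T2"
  for f :: "tri \<Rightarrow> 'a::ab_semigroup_add"
  by (rule tri_cases[of k]) (simp_all add: add_ac)

lemma W_set_len: "f \<in> W_set \<Longrightarrow> length (f w) = length w"
  and W_set_take: "f \<in> W_set \<Longrightarrow> take (length u) (f (u @ v)) = f u"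
  and W_set_bij: "f \<in> W_set \<Longrightarrow> bij f"
  by (simp_all add: W_set_def)

lemma W_set_Nil [simp]: "f \<in> W_set \<Longrightarrow> f [] = []"
  using W_set_len[of f "[]"] by simp

lemma W_set_Cons: "f \<in> W_set \<Longrightarrow> f (y # w) = hd (f [y]) # tl (f (y # w))"
  using W_set_len[of f "[y]"] W_set_len[of f "y # w"] W_set_take[of f "[y]" w]
  by (cases "f (y # w)"; cases "f [y]") auto

lemma W_set_id: "id \<in> W_set"
  by (simp add: W_set_def)

lemma W_set_comp:
  assumes f: "f \<in> W_set" and g: "g \<in> W_set" shows "f \<circ> g \<in> W_set"
proof -
  have "take (length u) (f (g (u @ v))) = f (g u)" for u v
    using W_set_take[OF f, of "take (length u) (g (u @ v))" "drop (length u) (g (u @ v))"]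
      W_set_take[OF g, of u v] W_set_len[OF g, of u] by (metis append_take_drop_id)
  then show ?thesis
    using f g by (auto simp: W_set_def bij_comp)
qed

lemma W_set_inv:
  assumes f: "f \<in> W_set" shows "inv_into UNIV f \<in> W_set"
proof -
  have b: "bij f" using f by (rule W_set_bij)
  have ff: "f (inv_into UNIV f w) = w" "inv_into UNIV f (f w) = w" for w
    using b by (simp_all add: bij_is_surj surj_f_inv_f bij_is_inj)
  have len: "length (inv_into UNIV f w) = length w" for w
    using W_set_len[OF f, of "inv_into UNIV f w"] ff by simp
  have "take (length u) (inv_into UNIV f (u @ v)) = inv_into UNIV f u" for u v
  proof -
    let ?p = "take (length u) (inv_into UNIV f (u @ v))"
    have l: "length ?p = length u" using len[of "u @ v"] by simp
    have "f ?p = take (length ?p) (f (?p @ drop (length u) (inv_into UNIV f (u @ v))))"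
      by (simp only: W_set_take[OF f])
    also have "\<dots> = u" using l ff by simp
    finally show ?thesis using ff by metis
  qed
  then show ?thesis using b len by (simp add: W_set_def bij_imp_bij_inv)
qed

text \<open>The group \<^const>\<open>W\<close> is written additively, so that it can be an instance of \<^class>\<open>group_add\<close>,
  the type class of not necessarily commutative groups.\<close>

typedef aut = W_set
  using W_set_id by blast

setup_lifting type_definition_aut

instantiation aut :: group_add
begin

lift_definition zero_aut :: aut is id by (rule W_set_id)
lift_definition plus_aut :: "aut \<Rightarrow> aut \<Rightarrow> aut" is "\<lambda>g h. h \<circ> g"
  by (rule W_set_comp)
lift_definition uminus_aut :: "aut \<Rightarrow> aut" is "inv_into UNIV" by (rule W_set_inv)
definition minus_aut :: "aut \<Rightarrow> aut \<Rightarrow> aut" where "minus_aut g h = g + - h"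

instance
proof
  fix a b c :: aut
  show "a + b + c = a + (b + c)" by transfer (simp add: comp_assoc)
  show "0 + a = a" by transfer simp
  show "a + 0 = a" by transfer simp
  show "- a + a = 0"
    by transfer (metis W_set_bij bij_is_surj surj_iff)
  show "a + - b = a - b" by (simp add: minus_aut_def)
qed

end

section \<open>First-level action and sections\<close>

lift_definition act :: "aut \<Rightarrow> tri \<Rightarrow> tri" is "\<lambda>f y. hd (f [y])" .

lift_definition sec :: "aut \<Rightarrow> tri \<Rightarrow> aut" is "\<lambda>f y w. tl (f (y # w))"
proof -
  fix f y assume f: "f \<in> W_set"
  let ?g = "\<lambda>w. tl (f (y # w))"
  have b: "bij f" using f by (rule W_set_bij)
  have eq: "f (y # w) = hd (f [y]) # ?g w" for w using W_set_Cons[OF f] .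
  have inj: "inj ?g"
  proof (rule injI)
    fix u v assume "?g u = ?g v"
    then have "f (y # u) = f (y # v)" using eq[of u] eq[of v] by simp
    then show "u = v" using b by (auto dest: bij_is_inj injD)
  qed
  have "surj ?g"
    unfolding surj_def
  proof
    fix v
    obtain t where t: "f t = hd (f [y]) # v" using b by (metis bij_pointE)
    then have "length t = Suc (length v)" using W_set_len[OF f, of t] by simp
    then obtain z w where zw: "t = z # w" by (cases t) auto
    have "hd (f [z]) = hd (f [y])" using t zw W_set_Cons[OF f, of z w] by simp
    then have "f [z] = f [y]"
      using W_set_len[OF f, of "[z]"] W_set_len[OF f, of "[y]"]
      by (cases "f [z]"; cases "f [y]") auto
    then have "z = y" using b by (auto dest: bij_is_inj injD)
    then show "\<exists>w. v = ?g w" using t zw by (metis list.sel(3))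
  qed
  moreover have "take (length u) (?g (u @ v)) = ?g u" for u v
    using W_set_take[OF f, of "y # u" v] eq[of "u @ v"] eq[of u] by (metis append_Cons length_Cons list.sel(3) take_Suc_Cons)
  ultimately show "?g \<in> W_set"
    using inj W_set_len[OF f] by (simp add: W_set_def bij_def)
qed

lemma Rep_aut_Cons: "Rep_aut g (y # w) = act g y # Rep_aut (sec g y) w"
  unfolding act.rep_eq sec.rep_eq by (rule W_set_Cons[OF Rep_aut])

lemma Rep_aut_Nil [simp]: "Rep_aut g [] = []"
  using Rep_aut by simp

lemma aut_eqI:
  assumes "\<And>y. act g y = act h y" "\<And>y. sec g y = sec h y" shows "g = h"
proof -
  have "Rep_aut g w = Rep_aut h w" for w
    by (cases w) (simp_all add: Rep_aut_Cons assms)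
  then show ?thesis by (simp add: Rep_aut_inject[symmetric] fun_eq_iff)
qed

lemma Rep_plus: "Rep_aut (g + h) = Rep_aut h \<circ> Rep_aut g"
  by (rule plus_aut.rep_eq)

lemma act_sec_plus: "act (g + h) y = act h (act g y) \<and> sec (g + h) y = sec g y + sec h (act g y)"
proof -
  have *: "act (g + h) y # Rep_aut (sec (g + h) y) w
      = act h (act g y) # Rep_aut (sec g y + sec h (act g y)) w" for w
    unfolding Rep_aut_Cons[symmetric] Rep_plus by (simp add: Rep_aut_Cons Rep_plus)
  then show ?thesis by (auto simp: Rep_aut_inject[symmetric] fun_eq_iff)
qed

lemma act_plus [simp]: "act (g + h) y = act h (act g y)"
  and sec_plus: "sec (g + h) y = sec g y + sec h (act g y)"
  by (simp_all add: act_sec_plus)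

lemma act_zero [simp]: "act 0 y = y"
  by (simp add: act.rep_eq zero_aut.rep_eq)

lemma sec_zero [simp]: "sec 0 y = 0"
  by (simp add: Rep_aut_inject[symmetric] sec.rep_eq zero_aut.rep_eq fun_eq_iff)

lemma act_minus_act [simp]: "act (- g) (act g y) = y" "act g (act (- g) y) = y"
  using act_plus[of g "- g" y] act_plus[of "- g" g y] by (simp_all del: act_plus)

lemma sec_minus: "sec (- g) y = - sec g (act (- g) y)"
proof -
  have "sec (- g) y + sec g (act (- g) y) = 0"
    using sec_plus[of "- g" g y] by simp
  then show ?thesis by (simp add: eq_neg_iff_add_eq_0)
qed

lemma sec_minus_act: "sec (- g) (act g y) = - sec g y"
  by (simp add: sec_minus)

lemma act_eq_iff [simp]: "act g y = act g z \<longleftrightarrow> y = z"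
  by (metis act_minus_act(1))

lemma ex_act: "\<exists>z. y = act g z"
  by (rule exI[of _ "act (- g) y"]) simp

lemma node_in_W:
  assumes "\<And>y. h y \<in> W_set"
  shows "(\<lambda>w. case w of [] \<Rightarrow> [] | y # v \<Rightarrow> y # h y v) \<in> W_set" (is "?f \<in> _")
proof -
  have "inj ?f"
  proof (rule injI)
    fix u v assume "?f u = ?f v"
    then show "u = v"
      using W_set_bij[OF assms] by (auto split: list.splits dest: bij_is_inj injD)
  qed
  moreover have "surj ?f"
    unfolding surj_def
  proof
    fix v show "\<exists>u. v = ?f u"
    proof (cases v)
      case Nil then show ?thesis by (intro exI[of _ "[]"]) simp
    next
      case (Cons y t)
      obtain s where "h y s = t" using W_set_bij[OF assms] by (metis bij_pointE)
      then show ?thesis using Cons by (intro exI[of _ "y # s"]) simp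
    qed
  qed
  moreover have "length (?f w) = length w" for w
    using W_set_len[OF assms] by (cases w) auto
  moreover have "take (length u) (?f (u @ v)) = ?f u" for u v
    using W_set_take[OF assms] by (cases u) auto
  ultimately show ?thesis by (simp add: W_set_def bij_def)
qed

lift_definition node :: "(tri \<Rightarrow> aut) \<Rightarrow> aut" is
  "\<lambda>h w. case w of [] \<Rightarrow> [] | y # v \<Rightarrow> y # h y v"
  by (rule node_in_W) simp

lemma act_node [simp]: "act (node h) y = y"
  by transfer simp

lemma sec_node [simp]: "sec (node h) y = h y"
  by transfer (simp add: fun_eq_iff)

lemma xx_cube: "xx (xx (xx w)) = w"
proof (cases w)
  case (Cons y t)
  then show ?thesis by (cases y) auto
qed simp

lemma gam_cube: "gam (gam (gam w)) = w"
  by (induction w rule: gam.induct) (simp_all add: xx_cube)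

lemma xx_in_W: "xx \<in> W_set"
proof -
  have "bij xx" by (rule o_bij[of "xx \<circ> xx"]) (simp_all add: fun_eq_iff xx_cube)
  moreover have "length (xx w) = length w" for w by (cases w) auto
  moreover have "take (length u) (xx (u @ v)) = xx u" for u v by (cases u) auto
  ultimately show ?thesis by (simp add: W_set_def)
qed

lemma gam_in_W: "gam \<in> W_set"
proof -
  have "bij gam" by (rule o_bij[of "gam \<circ> gam"]) (simp_all add: fun_eq_iff gam_cube)
  moreover have "length (gam w) = length w" for w
    by (induction w rule: gam.induct) (auto simp: W_set_len[OF xx_in_W])
  moreover have "take (length u) (gam (u @ v)) = gam u" for u v
    by (induction u rule: gam.induct) (auto simp: W_set_take[OF xx_in_W])
  ultimately show ?thesis by (simp add: W_set_def)
qed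

lift_definition X :: aut is xx by (rule xx_in_W)
lift_definition Gam :: aut is gam by (rule gam_in_W)

abbreviation diag :: "aut \<Rightarrow> aut" where "diag g \<equiv> node (\<lambda>_. g)"

lemma Rep_diag: "Rep_aut (diag g) = Delta (Rep_aut g)"
proof
  show "Rep_aut (diag g) w = Delta (Rep_aut g) w" for w
    by (cases w) (simp_all add: Rep_aut_Cons)
qed

lemma act_X [simp]: "act X y = y + T1"
  by (simp add: act.rep_eq X.rep_eq cyc_eq_plus)

lemma sec_X [simp]: "sec X y = 0"
  by (simp add: Rep_aut_inject[symmetric] sec.rep_eq X.rep_eq zero_aut.rep_eq fun_eq_iff)

lemma act_Gam [simp]: "act Gam y = y"
  by (cases y) (simp_all add: act.rep_eq Gam.rep_eq)

lemma sec_Gam: "sec Gam y = (if y = 0 then Gam else if y = T1 then X else 0)"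
  by (cases y) (simp_all add: Rep_aut_inject[symmetric] sec.rep_eq Gam.rep_eq X.rep_eq
      zero_aut.rep_eq fun_eq_iff zero_tri_def)

lemma X_triple: "X + X + X = 0"
  by (simp add: Rep_aut_inject[symmetric] plus_aut.rep_eq zero_aut.rep_eq X.rep_eq fun_eq_iff xx_cube)

lemma Gam_triple: "Gam + Gam + Gam = 0"
  by (simp add: Rep_aut_inject[symmetric] plus_aut.rep_eq zero_aut.rep_eq Gam.rep_eq fun_eq_iff gam_cube)

text \<open>Exponents are taken mod 3; this is a homomorphism in the exponent exactly when
  \<open>g + g + g = 0\<close>.\<close>

definition pw :: "aut \<Rightarrow> tri \<Rightarrow> aut" where
  "pw g e = (case e of T0 \<Rightarrow> 0 | T1 \<Rightarrow> g | T2 \<Rightarrow> g + g)"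

lemma pw_simps [simp]: "pw g 0 = 0" "pw g T1 = g"
  by (simp_all add: pw_def zero_tri_def)

lemma pw_T2: "pw g T2 = g + g"
  by (simp add: pw_def)

lemma pw_plus:
  assumes "g + g + g = 0" shows "pw g (a + b) = pw g a + pw g b"
proof -
  have [simp]: "g + (g + g) = 0" "g + (g + (g + g)) = g" using assms by (simp_all add: add.assoc)
  show ?thesis
    by (rule tri_cases[of a]; rule tri_cases[of b]; simp add: pw_T2 add.assoc)
qed

lemma pw_uminus:
  assumes "g + g + g = 0" shows "pw g (- a) = - pw g a"
  using pw_plus[OF assms, of "- a" a] by (simp add: eq_neg_iff_add_eq_0)

abbreviation xp :: "tri \<Rightarrow> aut" where "xp \<equiv> pw X"
abbreviation gp :: "tri \<Rightarrow> aut" where "gp \<equiv> pw Gam"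

lemmas xp_plus = pw_plus[OF X_triple] and gp_plus = pw_plus[OF Gam_triple]
  and xp_uminus = pw_uminus[OF X_triple] and gp_uminus = pw_uminus[OF Gam_triple]

lemma act_xp [simp]: "act (xp i) y = y + i"
  by (rule tri_cases[of i]) (simp_all add: pw_T2 add.assoc)

lemma sec_xp [simp]: "sec (xp i) y = 0"
  by (rule tri_cases[of i]) (simp_all add: pw_T2 sec_plus)

lemma act_gp [simp]: "act (gp i) y = y"
  by (rule tri_cases[of i]) (simp_all add: pw_T2)

lemma sec_gp: "sec (gp e) y = (if y = 0 then gp e else if y = T1 then xp e else 0)"
  by (rule tri_cases[of e]) (simp_all add: pw_T2 sec_plus sec_Gam)

text \<open>On the group \<open>PhiA\<close> below, \<open>label\<close> and \<open>label_sum\<close> are the exponent sums modulo 3 in the two generators.\<close>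

definition label :: "aut \<Rightarrow> tri" where "label g = act g 0"

definition rot :: "aut \<Rightarrow> bool" where "rot g \<longleftrightarrow> (\<forall>y. act g y = y + label g)"

definition label_sum :: "aut \<Rightarrow> tri" where "label_sum g = label (sec g 0) + label (sec g T1) + label (sec g T2)"

lemma act_rot: "rot g \<Longrightarrow> act g y = y + label g"
  by (simp add: rot_def)

lemma label_simps [simp]: "label 0 = 0" "label X = T1" "label Gam = 0" "label (xp i) = i" "label (gp e) = 0" "label (node h) = 0"
  by (simp_all add: label_def)

lemma rot_simps [simp]: "rot 0" "rot X" "rot Gam" "rot (xp i)" "rot (gp e)" "rot (node h)"
  by (simp_all add: rot_def)

lemma label_plus: "rot h \<Longrightarrow> label (g + h) = label g + label h"
  using act_rot[of h "act g 0"] by (simp add: label_def)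

lemma rot_plus: "rot g \<Longrightarrow> rot h \<Longrightarrow> rot (g + h)"
  by (simp add: rot_def label_plus add.assoc)

lemma rot_uminus: assumes "rot g" shows "rot (- g)" and "label (- g) = - label g"
proof -
  have *: "act (- g) y = y - label g" for y
    using act_minus_act(1)[of g "y - label g"] act_rot[OF assms, of "y - label g"]
    by (metis diff_add_cancel)
  then show "label (- g) = - label g" by (simp add: label_def)
  with * show "rot (- g)" by (simp add: rot_def)
qed

lemma label_sum_plus:
  assumes "rot f" "\<And>y. rot (sec h y)" shows "label_sum (f + h) = label_sum f + label_sum h"
proof -
  have "label_sum (f + h) = label_sum f + (label (sec h (label f)) + label (sec h (T1 + label f)) + label (sec h (T2 + label f)))"
    using assms by (simp add: label_sum_def sec_plus label_plus act_rot add_ac)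
  then show ?thesis by (simp add: tri_sum_shift[of "\<lambda>y. label (sec h y)"] label_sum_def)
qed

lemma label_sum_simps [simp]: "label_sum 0 = 0" "label_sum X = 0" "label_sum Gam = T1" "label_sum (xp i) = 0" "label_sum (gp e) = e"
  by (simp_all add: label_sum_def sec_Gam sec_gp)

section \<open>Sections of elements of the Fabrykowski--Gupta group\<close>

text \<open>Right multiplication by the generators suffices: both have order 3, so inverses are
  positive words. Inductions then append one generator at a time.\<close>

inductive_set PhiA :: "aut set" where
  zero [simp]: "0 \<in> PhiA"
| X_step: "f \<in> PhiA \<Longrightarrow> f + X \<in> PhiA"
| Gam_step: "f \<in> PhiA \<Longrightarrow> f + Gam \<in> PhiA"

lemma PhiA_gens [simp]: "X \<in> PhiA" "Gam \<in> PhiA"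
  using PhiA.X_step[of 0] PhiA.Gam_step[of 0] by simp_all

lemma PhiA_plus: "g \<in> PhiA \<Longrightarrow> f \<in> PhiA \<Longrightarrow> f + g \<in> PhiA"
  by (induction rule: PhiA.induct) (auto simp flip: add.assoc intro: PhiA.intros)

lemma PhiA_pw [simp]: "g \<in> PhiA \<Longrightarrow> pw g e \<in> PhiA"
  by (rule tri_cases[of e]) (simp_all add: pw_T2 PhiA_plus)

lemma PhiA_uminus: "f \<in> PhiA \<Longrightarrow> - f \<in> PhiA"
proof (induction rule: PhiA.induct)
  case (X_step f)
  have "- X = xp T2" using xp_uminus[of T1] by simp
  with X_step show ?case using PhiA_plus[of "- f" "xp T2"] by (simp add: minus_add)
next
  case (Gam_step f)
  have "- Gam = gp T2" using gp_uminus[of T1] by simp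
  with Gam_step show ?case using PhiA_plus[of "- f" "gp T2"] by (simp add: minus_add)
qed simp

lemma PhiA_rot: "f \<in> PhiA \<Longrightarrow> rot f"
  by (induction rule: PhiA.induct) (auto intro: rot_plus)

lemma PhiA_sec: "f \<in> PhiA \<Longrightarrow> sec f y \<in> PhiA"
  by (induction rule: PhiA.induct) (auto simp: sec_plus sec_Gam intro: PhiA_plus)

lemma PhiA_label_plus: "h \<in> PhiA \<Longrightarrow> label (g + h) = label g + label h"
  by (simp add: PhiA_rot label_plus)

lemma PhiA_label_sum_plus: "g \<in> PhiA \<Longrightarrow> h \<in> PhiA \<Longrightarrow> label_sum (g + h) = label_sum g + label_sum h"
  by (simp add: label_sum_plus PhiA_rot PhiA_sec)

lemma PhiA_label_uminus: "g \<in> PhiA \<Longrightarrow> label (- g) = - label g"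
  by (simp add: PhiA_rot rot_uminus)

lemma PhiA_label_sum_uminus: "g \<in> PhiA \<Longrightarrow> label_sum (- g) = - label_sum g"
  using PhiA_label_sum_plus[of "- g" g] by (simp add: PhiA_uminus eq_neg_iff_add_eq_0)

lemma PhiA_minus: "f \<in> PhiA \<Longrightarrow> g \<in> PhiA \<Longrightarrow> f - g \<in> PhiA"
  using PhiA_plus[OF PhiA_uminus, of g f] by simp

lemma PhiA_label_minus: "g \<in> PhiA \<Longrightarrow> label (f - g) = label f - label g"
  using PhiA_label_plus[OF PhiA_uminus, of g f] by (simp add: PhiA_label_uminus)

lemma PhiA_label_sum_minus: "f \<in> PhiA \<Longrightarrow> g \<in> PhiA \<Longrightarrow> label_sum (f - g) = label_sum f - label_sum g"
  using PhiA_label_sum_plus[OF _ PhiA_uminus, of f g] by (simp add: PhiA_label_sum_uminus)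

text \<open>In \<open>Gam\<close>, the section \<open>Gam\<close> at 0 is followed by the section
  \<open>X\<close> at \<open>T1\<close>, and all other exponents vanish. Rotations shift both sides
  alike and exponents add, so the relation passes to products.\<close>

lemma PhiA_label_sum_sec: "f \<in> PhiA \<Longrightarrow> label_sum (sec f y) = label (sec f (y + T1))"
proof (induction rule: PhiA.induct)
  case (Gam_step f)
  have Gam: "label_sum (sec Gam z) = label (sec Gam (z + T1))" for z
    by (rule tri_cases[of z]) (simp_all add: sec_Gam)
  have *: "sec Gam z \<in> PhiA" for z by (simp add: PhiA_sec)
  show ?case
    using Gam_step PhiA_rot[of f] *
    by (simp add: sec_plus PhiA_label_sum_plus PhiA_label_plus PhiA_sec Gam act_rot add_ac)
qed (simp_all add: sec_plus)

text \<open>Self-replication: at \<open>T1\<close>, \<open>Gam\<close> has section \<open>X\<close>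
  and its conjugate by \<open>X\<close> has section \<open>Gam\<close>, so every word lifts there.
  Conjugation by a power of \<open>X\<close> moves \<open>T1\<close> to \<open>z\<close>.\<close>

lemma PhiA_lift: assumes "f \<in> PhiA" shows "\<exists>F\<in>PhiA. (\<forall>y. act F y = y) \<and> sec F z = f"
proof -
  have "\<exists>H\<in>PhiA. (\<forall>y. act H y = y) \<and> sec H T1 = f"
    using assms
  proof (induction rule: PhiA.induct)
    case zero show ?case by (intro bexI[of _ 0]) simp_all
  next
    case (X_step f)
    then obtain H where "H \<in> PhiA" "\<forall>y. act H y = y" "sec H T1 = f" by blast
    then show ?case by (intro bexI[of _ "H + Gam"]) (simp_all add: PhiA_plus sec_plus sec_Gam)
  next
    case (Gam_step f)
    then obtain H where "H \<in> PhiA" "\<forall>y. act H y = y" "sec H T1 = f" by blast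
    then show ?case
      by (intro bexI[of _ "H + (xp T2 + Gam + X)"])
        (simp_all add: PhiA_plus sec_plus sec_Gam add.assoc)
  qed
  then obtain H where "H \<in> PhiA" "\<And>y. act H y = y" "sec H T1 = f" by blast
  then show ?thesis
    by (intro bexI[of _ "xp (T1 - z) + H + xp (z - T1)"]) (simp_all add: sec_plus PhiA_plus)
qed

section \<open>Branching: elements supported on one subtree\<close>

definition nd :: "tri \<Rightarrow> aut \<Rightarrow> aut" where "nd y f = node (\<lambda>z. if z = y then f else 0)"

lemma act_nd [simp]: "act (nd y f) z = z" and sec_nd: "sec (nd y f) z = (if z = y then f else 0)"
  by (simp_all add: nd_def)

lemma nd_zero [simp]: "nd y 0 = 0"
  by (rule aut_eqI) (simp_all add: sec_nd)

lemma nd_plus: "nd y (f + g) = nd y f + nd y g"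
  by (rule aut_eqI) (simp_all add: sec_nd sec_plus)

text \<open>Turns out to consist of the elements of \<open>PhiA\<close> with both exponents 0
  (\<open>Mid_labels\<close>, \<open>nd_PhiA\<close>), that is, of its commutator subgroup.\<close>

definition Mid :: "aut set" where "Mid = {f. nd T1 f \<in> PhiA}"

lemma Mid_plus: "f \<in> Mid \<Longrightarrow> g \<in> Mid \<Longrightarrow> f + g \<in> Mid"
  by (simp add: Mid_def nd_plus PhiA_plus)

lemma Mid_PhiA: "f \<in> Mid \<Longrightarrow> f \<in> PhiA"
  using PhiA_sec[of "nd T1 f" T1] by (simp add: Mid_def sec_nd)

lemma act_id_minus: "(\<And>y. act H y = y) \<Longrightarrow> act (- H) y = y"
  by (metis act_minus_act(1))

lemma Mid_conj:
  assumes f: "f \<in> Mid" and h: "h \<in> PhiA" shows "- h + f + h \<in> Mid"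
proof -
  obtain H where H: "H \<in> PhiA" "\<And>y. act H y = y" "sec H T1 = h"
    using PhiA_lift[OF h] by blast
  have [simp]: "act (- H) y = y" for y using H(2) by (rule act_id_minus)
  have "nd T1 (- h + f + h) = - H + nd T1 f + H"
    by (rule aut_eqI) (auto simp: sec_nd sec_plus sec_minus H add.assoc)
  then show ?thesis using f H by (simp add: Mid_def PhiA_plus PhiA_uminus)
qed

text \<open>The supports of \<open>Gam\<close> and of its conjugate \<open>H\<close> by
  \<open>X\<close> meet only at \<open>T1\<close>, where the sections are \<open>X\<close> and
  \<open>Gam\<close>; hence their commutator lives at \<open>T1\<close> alone.\<close>

lemma comm_M: "- gp j - X + gp j + X \<in> Mid"
proof -
  have *: "- Gam - X + Gam + X \<in> Mid"
  proof -
    define H where "H = xp T2 + Gam + X"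
    have H [simp]: "act H y = y" "sec H y = (if y = T1 then Gam else if y = T2 then X else 0)" "H \<in> PhiA" for y
      by (rule tri_cases[of y]; simp add: H_def sec_plus sec_Gam add.assoc PhiA_plus)+
    have [simp]: "act (- Gam) y = y" "act (- H) y = y" for y
      by (simp_all add: act_id_minus)
    have "nd T1 (- Gam - X + Gam + X) = - H - Gam + H + Gam"
    proof (rule aut_eqI)
      show "sec (nd T1 (- Gam - X + Gam + X)) y = sec (- H - Gam + H + Gam) y" for y
        by (rule tri_cases[of y])
          (simp_all add: sec_nd sec_plus sec_minus sec_Gam add.assoc diff_conv_add_uminus del: add_uminus_conv_diff)
    qed (simp add: diff_conv_add_uminus del: add_uminus_conv_diff)
    moreover have "- H - Gam + H + Gam \<in> PhiA"
      by (simp add: PhiA_plus PhiA_uminus diff_conv_add_uminus del: add_uminus_conv_diff)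
    ultimately show ?thesis by (simp add: Mid_def)
  qed
  have "0 \<in> Mid" by (simp add: Mid_def)
  \<comment> \<open>The identity [g^2, x] = [g, x]^g [g, x] reduces exponent 2 to exponent
    1.\<close>
  moreover have "- (Gam + Gam) - X + (Gam + Gam) + X = (- Gam + (- Gam - X + Gam + X) + Gam) + (- Gam - X + Gam + X)"
    by (simp add: add.assoc minus_add diff_conv_add_uminus del: add_uminus_conv_diff)
  ultimately show ?thesis
    using * Mid_plus[OF Mid_conj[OF *, of Gam] *]
    by - (rule tri_cases[of j], simp_all add: pw_T2)
qed

text \<open>Modulo \<open>Mid\<close>, which is stable under conjugation, the generators commute by
  \<open>comm_M\<close>, so their exponents can be collected.\<close>

lemma PhiA_decomp: "f \<in> PhiA \<Longrightarrow> \<exists>i j. \<exists>m\<in>Mid. f = xp i + gp j + m"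
proof (induction rule: PhiA.induct)
  case zero
  have "0 \<in> Mid" by (simp add: Mid_def)
  then show ?case by (intro exI[of _ 0] bexI[of _ 0]) simp_all
next
  case (X_step f)
  then obtain i j m where m: "m \<in> Mid" and f: "f = xp i + gp j + m" by blast
  have "f + X = xp (i + T1) + gp j + ((- gp j - X + gp j + X) + (- X + m + X))"
    unfolding f by (simp add: xp_plus add.assoc minus_add diff_conv_add_uminus del: add_uminus_conv_diff)
  then show ?case using m by (meson Mid_conj Mid_plus PhiA_gens comm_M)
next
  case (Gam_step f)
  then obtain i j m where m: "m \<in> Mid" and f: "f = xp i + gp j + m" by blast
  have "f + Gam = xp i + gp (j + T1) + (- Gam + m + Gam)"
    unfolding f by (simp add: gp_plus add.assoc)
  then show ?case using m by (meson Mid_conj PhiA_gens)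
qed

text \<open>Apply \<open>PhiA_label_sum_sec\<close> to \<open>nd T1 f\<close>: the sections next to
  \<open>T1\<close> are trivial, so the relation at 0 gives the first claim and the one at
  \<open>T1\<close> the second.\<close>

lemma Mid_labels: assumes "f \<in> Mid" shows "label f = 0" "label_sum f = 0"
proof -
  have *: "nd T1 f \<in> PhiA" using assms by (simp add: Mid_def)
  show "label f = 0" using PhiA_label_sum_sec[OF *, of 0] by (simp add: sec_nd)
  show "label_sum f = 0" using PhiA_label_sum_sec[OF *, of T1] by (simp add: sec_nd)
qed

text \<open>The exponents in the normal form of \<open>f\<close> are \<open>label f\<close> and
  \<open>label_sum f\<close>, so only the \<open>Mid\<close> part remains. Conjugation by a power of
  \<open>X\<close> moves it from \<open>T1\<close> to \<open>y\<close>.\<close>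

lemma nd_PhiA: assumes f: "f \<in> PhiA" "label f = 0" "label_sum f = 0" shows "nd y f \<in> PhiA"
proof -
  obtain i j m where m: "m \<in> Mid" and eq: "f = xp i + gp j + m" using PhiA_decomp[OF f(1)] by blast
  have "label f = i" "label_sum f = j"
    unfolding eq using m Mid_PhiA[OF m] Mid_labels[OF m] by (simp_all add: PhiA_label_plus PhiA_label_sum_plus PhiA_plus)
  then have "f \<in> Mid" using eq m f by simp
  moreover have "nd y f = xp (T1 - y) + nd T1 f + xp (y - T1)"
    by (rule aut_eqI) (auto simp: sec_nd sec_plus algebra_simps)
  ultimately show ?thesis by (simp add: Mid_def PhiA_plus)
qed

text \<open>The \<open>e\<close>-th power of a conjugate of \<gamma>, indexed so that the section
  \<open>gp e\<close> sits at \<open>i\<close> and \<open>xp e\<close> at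
  \<open>i + T1\<close>.\<close>

definition Gm :: "tri \<Rightarrow> tri \<Rightarrow> aut" where "Gm i e = xp (- i) + gp e + xp i"

lemma Gm_PhiA [simp]: "Gm i e \<in> PhiA"
  by (simp add: Gm_def PhiA_plus)

lemma act_Gm [simp]: "act (Gm i e) y = y"
  by (simp add: Gm_def)

lemma sec_Gm: "sec (Gm i e) y = (if y = i then gp e else if y = i + T1 then xp e else 0)"
  by (auto simp: Gm_def sec_plus sec_gp algebra_simps)

text \<open>From right to left: divide \<open>f\<close> by an element \<open>h\<close> of the group
  with the same rotation and the same exponents in every section. The quotient is a product of three
  elements covered by \<open>nd_PhiA\<close>.\<close>

theorem PhiA_iff:
  "f \<in> PhiA \<longleftrightarrow> rot f \<and> (\<forall>y. sec f y \<in> PhiA \<and> label_sum (sec f y) = label (sec f (y + T1)))" (is "_ \<longleftrightarrow> ?R f")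
proof
  assume "?R f"
  define a where "a y = label_sum (sec f y)" for y
  \<comment> \<open>\<open>Gm y (a y)\<close> gives the section at \<open>y\<close> the
    \<gamma>-exponent \<open>a y\<close>, and the next one the same x-exponent.\<close>
  define h where "h = Gm 0 (a 0) + Gm T1 (a T1) + Gm T2 (a T2) + xp (label f)"
  define d where "d = f - h"
  have hP: "h \<in> PhiA" by (simp add: h_def PhiA_plus)
  have acth: "act h y = y + label f" for y by (simp add: h_def)
  have rd: "act d y = y" for y
    using \<open>?R f\<close> act_minus_act(1)[of h y]
    by (simp add: d_def act_rot diff_conv_add_uminus acth del: add_uminus_conv_diff)
  have sd: "sec d y = sec f y - sec h y" for y
    using \<open>?R f\<close> sec_minus_act[of h y]
    by (simp add: d_def act_rot diff_conv_add_uminus acth sec_plus del: add_uminus_conv_diff)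
  have sech: "label (sec h y) = a (y + T2)" "label_sum (sec h y) = a y" for y
    by (rule tri_cases[of y]; simp add: h_def sec_plus sec_Gm PhiA_label_plus PhiA_label_sum_plus)+
  have dP: "sec d y \<in> PhiA" for y
    using \<open>?R f\<close> hP by (simp add: sd PhiA_sec PhiA_minus)
  have "label (sec d y) = 0 \<and> label_sum (sec d y) = 0" for y
  proof -
    have "label_sum (sec f (y + T2)) = label (sec f y)"
      using \<open>?R f\<close> by (metis tri_plus_simps(3) add.assoc add.right_neutral)
    then show ?thesis
      using \<open>?R f\<close> hP sech[of y] unfolding sd a_def
      by (simp only: PhiA_label_minus PhiA_label_sum_minus PhiA_sec) simp
  qed
  then have "nd y (sec d y) \<in> PhiA" for y using dP by (simp add: nd_PhiA)
  moreover have "d = nd 0 (sec d 0) + nd T1 (sec d T1) + nd T2 (sec d T2)"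
  proof (rule aut_eqI)
    show "sec d y = sec (nd 0 (sec d 0) + nd T1 (sec d T1) + nd T2 (sec d T2)) y" for y
      by (rule tri_cases[of y]) (simp_all add: sec_plus sec_nd)
  qed (simp add: rd)
  ultimately have "d \<in> PhiA" by (metis PhiA_plus)
  then show "f \<in> PhiA" using PhiA_plus[OF hP, of d] by (simp add: d_def)
qed (simp add: PhiA_rot PhiA_sec PhiA_label_sum_sec)

section \<open>The normalizer\<close>

definition cj :: "aut \<Rightarrow> aut \<Rightarrow> aut" where "cj g f = - g + f + g"

lemma rotI: "(\<And>y. act g y = y + c) \<Longrightarrow> rot g"
  by (simp add: rot_def label_def)

lemma cj_plus_left: "cj (g + h) f = cj h (cj g f)"
  by (simp add: cj_def minus_add add.assoc diff_conv_add_uminus del: add_uminus_conv_diff)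

lemma cj_minus_cj [simp]: "cj (- g) (cj g f) = f" "cj g (cj (- g) f) = f"
  by (simp_all add: cj_def add.assoc)

lemma act_cj: "act (cj g f) (act g z) = act g (act f z)"
  by (simp add: cj_def)

lemma sec_cj: "sec (cj g f) (act g z) = - sec g z + sec f z + sec g (act f z)"
  by (simp add: cj_def sec_plus sec_minus_act)

lemma cj_zero [simp]: "cj 0 f = f"
  by (simp add: cj_def)

lemma PhiA_cj: "f \<in> PhiA \<Longrightarrow> h \<in> PhiA \<Longrightarrow> cj h f \<in> PhiA"
  by (simp add: cj_def PhiA_plus PhiA_uminus)

text \<open>Asking for both signs makes conjugation by \<open>g\<close> a bijection of
  \<open>PhiA\<close>, as the normalizer demands.\<close>

definition NPhi :: "aut set" where
  "NPhi = {g. \<forall>f\<in>PhiA. cj g f \<in> PhiA \<and> cj (- g) f \<in> PhiA}"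

lemma NPhi_cj: "g \<in> NPhi \<Longrightarrow> f \<in> PhiA \<Longrightarrow> cj g f \<in> PhiA"
  by (simp add: NPhi_def)

lemma NPhi_uminus: "g \<in> NPhi \<Longrightarrow> - g \<in> NPhi"
  by (simp add: NPhi_def)

lemma NPhi_plus: "g \<in> NPhi \<Longrightarrow> h \<in> NPhi \<Longrightarrow> g + h \<in> NPhi"
  by (simp add: NPhi_def cj_plus_left minus_add del: add_uminus_conv_diff add: diff_conv_add_uminus)

lemma PhiA_NPhi: "g \<in> PhiA \<Longrightarrow> g \<in> NPhi"
  by (simp add: NPhi_def PhiA_cj PhiA_uminus)

lemma X_neq [simp]: "X \<noteq> 0" and Gam_neq [simp]: "Gam \<noteq> 0"
  using label_simps(1,2) label_sum_simps(1,3) T_neq(1) by metis+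

text \<open>A permutation of the letters is a translation or a reflection; the last hypothesis
  excludes the reflections.\<close>

lemma tri_orientation:
  fixes a b c :: tri
  assumes "a \<noteq> b" "a \<noteq> c" "b \<noteq> c" "b \<noteq> c + T1"
  shows "a = 0 + (c + T1)" "b = T1 + (c + T1)" "c = T2 + (c + T1)"
  using assms by (cases a; cases b; cases c; simp add: plus_tri.simps zero_tri_def)+

text \<open>In \<open>cj g Gam\<close>, the trivial section at \<open>act g T2\<close> forces
  x-exponent 0 in the next section. At \<open>act g T1\<close> sits a conjugate of \<open>X\<close>,
  which fixes no letter, so that vertex is not the next one and \<open>g\<close> is no
  reflection.\<close>

lemma NPhi_rot: assumes g: "g \<in> NPhi" shows "rot g"
proof -
  define f where "f = cj g Gam"
  have fP: "f \<in> PhiA" using g by (simp add: f_def NPhi_cj)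
  have f1: "sec f (act g T1) = cj (sec g T1) X" and f2: "sec f (act g T2) = 0"
    by (simp_all add: f_def sec_cj sec_Gam) (simp add: cj_def)
  let ?k = "sec g T1" and ?j = "act g T2"
  have "label (cj ?k X) \<noteq> 0"
  proof -
    obtain z where z: "0 = act ?k z" using ex_act by blast
    have "label (cj ?k X) = act ?k (z + T1)"
      unfolding label_def using act_cj[of ?k X z] z by simp
    moreover have "act ?k (z + T1) \<noteq> act ?k z" by simp
    ultimately show ?thesis using z by simp
  qed
  moreover have "label (sec f (?j + T1)) = 0"
    using PhiA_label_sum_sec[OF fP, of ?j] by (simp add: f2)
  ultimately have k: "act g T1 \<noteq> ?j + T1" using f1 by metis
  have d: "act g 0 \<noteq> act g T1" "act g 0 \<noteq> ?j" "act g T1 \<noteq> ?j" by simp_all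
  note 1 = tri_orientation[OF d k]
  define c where "c = ?j + T1"
  have "act g y = y + c" for y
    unfolding c_def by (rule tri_cases[of y]) (hypsubst, rule 1)+
  then show ?thesis by (simp add: rot_def label_def)
qed

text \<open>Lift \<open>f\<close> to an element fixing the first level with section \<open>f\<close>
  at \<open>z\<close>: conjugating the lift by \<open>g\<close> conjugates \<open>f\<close> by
  \<open>sec g z\<close>.\<close>

lemma NPhi_sec: assumes g: "g \<in> NPhi" shows "sec g z \<in> NPhi"
proof -
  have *: "cj (sec g z) f \<in> PhiA" if g: "g \<in> NPhi" and f: "f \<in> PhiA" for g f z
  proof -
    obtain F where F: "F \<in> PhiA" "\<And>y. act F y = y" "sec F z = f"
      using PhiA_lift[OF f] by blast
    have "cj (sec g z) f = sec (cj g F) (act g z)"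
      by (simp add: sec_cj F cj_def[of "sec g z"])
    then show ?thesis using g F by (simp add: NPhi_cj PhiA_sec)
  qed
  have "cj (- sec g z) f \<in> PhiA" if "f \<in> PhiA" for f
    using *[OF NPhi_uminus[OF g] that, of "act g z"] by (simp add: sec_minus_act)
  with *[OF g] show ?thesis by (simp add: NPhi_def)
qed

text \<open>Labels of rotations add, and their values commute. With \<open>NPhi_label_sum\<close>
  this says that the normalizer acts trivially on the abelianization of \<open>PhiA\<close>.\<close>

lemma NPhi_label: "g \<in> NPhi \<Longrightarrow> f \<in> PhiA \<Longrightarrow> label (cj g f) = label f"
  by (simp add: cj_def label_plus NPhi_rot PhiA_rot rot_uminus)

lemma NPhi_label_sum: assumes g: "g \<in> NPhi" and f: "f \<in> PhiA" shows "label_sum (cj g f) = label_sum f"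
proof -
  have "label_sum (- g) + label_sum g = label_sum (- g + g)"
    using g by (subst label_sum_plus) (simp_all add: NPhi_rot NPhi_sec NPhi_uminus)
  moreover have "label_sum (cj g f) = label_sum (- g) + label_sum f + label_sum g"
    using g f unfolding cj_def
    by (subst label_sum_plus, simp_all add: rot_plus NPhi_rot NPhi_sec NPhi_uminus PhiA_rot, subst label_sum_plus)
      (simp_all add: NPhi_rot NPhi_uminus PhiA_rot PhiA_sec)
  ultimately show ?thesis by (simp add: add_ac)
qed

text \<open>These are the sections of \<open>cj g X\<close>. Hence all sections of \<open>g\<close>
  lie in one coset of \<open>PhiA\<close>.\<close>

lemma NPhi_sec_diff: assumes "g \<in> NPhi" shows "- sec g z + sec g (z + T1) \<in> PhiA"
  using PhiA_sec[OF NPhi_cj[OF assms, of X], of "act g z"] by (simp add: sec_cj)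

section \<open>Diagonal elements in the normalizer\<close>

lemma diag_plus: "diag (g + h) = diag g + diag h"
  by (rule aut_eqI) (simp_all add: sec_plus)

lemma diag_zero [simp]: "diag 0 = 0"
  by (rule aut_eqI) simp_all

lemma diag_uminus: "diag (- g) = - diag g"
  using diag_plus[of "- g" g] by (simp add: eq_neg_iff_add_eq_0)

lemma diag_inj: "diag g = diag h \<longleftrightarrow> g = h"
  by (metis sec_node)

lemma diag_xp: "diag g + xp i = xp i + diag g"
  by (rule aut_eqI) (simp_all add: sec_plus)

text \<open>By \<open>PhiA_iff\<close>: every section is conjugated by the same \<open>g\<close>,
  which preserves both exponents.\<close>

lemma NPhi_diag: assumes "g \<in> NPhi" shows "diag g \<in> NPhi"
proof -
  have "cj (diag g) f \<in> PhiA" if g: "g \<in> NPhi" and f: "f \<in> PhiA" for f g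
  proof -
    have a: "act (cj (diag g) f) y = act f y" for y
      using act_cj[of "diag g" f y] by simp
    have sc: "sec (cj (diag g) f) y = cj g (sec f y)" for y
      using sec_cj[of "diag g" f y] by (simp add: cj_def[of g])
    have "rot (cj (diag g) f)"
      by (rule rotI[of _ "label f"]) (simp add: a act_rot PhiA_rot[OF f])
    then show ?thesis
      using f g by (subst PhiA_iff) (simp add: sc NPhi_cj NPhi_label_sum NPhi_label PhiA_sec PhiA_label_sum_sec)
  qed
  from this[OF assms] this[OF NPhi_uminus[OF assms]] show ?thesis
    by (simp add: NPhi_def diag_uminus)
qed

text \<open>\<open>d y\<close> measures the failure of \<open>PhiA_iff\<close> at \<open>y\<close>.
  It is the same for all \<open>y\<close> because \<open>cj h X\<close> lies in the group, and
  \<open>diag (xp d)\<close> repairs it: it raises the \<open>label\<close> of each section by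
  \<open>d\<close> and leaves each \<open>label_sum\<close> alone.\<close>

lemma NPhi_sections_PhiA:
  assumes h: "h \<in> NPhi" "\<And>y. act h y = y" "\<And>y. sec h y \<in> PhiA"
  shows "\<exists>d. diag (xp d) + h \<in> PhiA"
proof -
  define d where "d y = label_sum (sec h y) - label (sec h (y + T1))" for y
  have w: "cj h X \<in> PhiA" using h by (simp add: NPhi_cj)
  have sw: "sec (cj h X) y = - sec h y + sec h (y + T1)" for y
    using sec_cj[of h X y] by (simp add: h(2))
  have "d (y + T1) = d y" for y
    using PhiA_label_sum_sec[OF w, of y] h(3)
    by (simp add: sw d_def PhiA_label_sum_plus PhiA_label_plus PhiA_label_uminus PhiA_label_sum_uminus PhiA_uminus algebra_simps)
  from this[of 0] this[of T1] have d: "d y = d 0" for y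
    by (rule_tac tri_cases[of y]) simp_all
  have "diag (xp (d 0)) + h \<in> PhiA"
  proof (subst PhiA_iff, intro conjI allI)
    show "rot (diag (xp (d 0)) + h)" by (simp add: rot_def label_def h(2))
    fix y
    show "sec (diag (xp (d 0)) + h) y \<in> PhiA" using h(3) by (simp add: sec_plus PhiA_plus)
    show "label_sum (sec (diag (xp (d 0)) + h) y) = label (sec (diag (xp (d 0)) + h) (y + T1))"
      using d[of y] h(3) by (simp add: sec_plus PhiA_label_sum_plus PhiA_label_plus d_def algebra_simps)
  qed
  then show ?thesis by blast
qed

section \<open>The complement\<close>

text \<open>Products of the \<Delta>^n(x) with n \<ge> 0, nested as x^i \<Delta>(v). The further
  \<open>diag\<close> in \<open>UA\<close> makes n start at 1.\<close>

inductive_set UA0 :: "aut set" where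
  zero [simp]: "0 \<in> UA0"
| step: "v \<in> UA0 \<Longrightarrow> xp i + diag v \<in> UA0"

definition UA :: "aut set" where "UA = diag ` UA0"

lemma UA0_plus: "v \<in> UA0 \<Longrightarrow> w \<in> UA0 \<Longrightarrow> v + w \<in> UA0"
proof (induction arbitrary: w rule: UA0.induct)
  case (step v i)
  show ?case
    using step.prems
  proof cases
    case (step w' j)
    have "xp i + diag v + (xp j + diag w') = xp (i + j) + diag (v + w')"
      by (metis diag_plus diag_xp add.assoc xp_plus)
    then show ?thesis using step step.IH UA0.step by (metis \<open>\<And>w. w \<in> UA0 \<Longrightarrow> v + w \<in> UA0\<close>)
  qed (simp add: step UA0.step)
qed simp

lemma UA0_commute: "v \<in> UA0 \<Longrightarrow> w \<in> UA0 \<Longrightarrow> v + w = w + v"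
proof (induction arbitrary: w rule: UA0.induct)
  case (step v i)
  show ?case
    using step.prems
  proof cases
    case (step w' j)
    have "xp i + diag v + (xp j + diag w') = xp (i + j) + diag (v + w')"
      by (metis diag_plus diag_xp add.assoc xp_plus)
    moreover have "xp j + diag w' + (xp i + diag v) = xp (j + i) + diag (w' + v)"
      by (metis diag_plus diag_xp add.assoc xp_plus)
    moreover have "v + w' = w' + v" by (rule \<open>\<And>w. w \<in> UA0 \<Longrightarrow> v + w = w + v\<close>) fact
    ultimately show ?thesis using step by (simp add: add.commute)
  qed simp
qed simp

lemma UA0_triple: "v \<in> UA0 \<Longrightarrow> v + v + v = 0"
proof (induction rule: UA0.induct)
  case (step v i)
  have "xp i + diag v + (xp i + diag v) + (xp i + diag v) = xp (i + i + i) + diag (v + v + v)"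
    by (metis diag_plus diag_xp add.assoc xp_plus)
  then show ?case using step by simp
qed simp

lemma UA0_uminus: assumes "v \<in> UA0" shows "- v \<in> UA0"
proof -
  have "- v = v + v" using UA0_triple[OF assms] by (simp add: neg_eq_iff_add_eq_0 add.assoc)
  then show ?thesis using assms by (simp add: UA0_plus)
qed

lemma UA0_xp: "xp i \<in> UA0"
  using UA0.step[OF UA0.zero, of i] by simp

lemma UA0_diag: "v \<in> UA0 \<Longrightarrow> diag v \<in> UA0"
  using UA0.step[of v 0] by simp

lemma UA_UA0: "u \<in> UA \<Longrightarrow> u \<in> UA0"
  by (auto simp: UA_def UA0_diag)

lemma UA_plus: "u \<in> UA \<Longrightarrow> v \<in> UA \<Longrightarrow> u + v \<in> UA"
  by (auto simp: UA_def UA0_plus simp flip: diag_plus)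

lemma UA_uminus: "u \<in> UA \<Longrightarrow> - u \<in> UA"
  by (auto simp: UA_def UA0_uminus simp flip: diag_uminus)

lemma UA_zero [simp]: "0 \<in> UA"
  by (auto simp: UA_def intro: image_eqI[of _ _ 0])

lemma UA0_NPhi: "v \<in> UA0 \<Longrightarrow> v \<in> NPhi"
  by (induction rule: UA0.induct) (simp_all add: NPhi_plus PhiA_NPhi NPhi_diag)

lemma UA_NPhi: "u \<in> UA \<Longrightarrow> u \<in> NPhi"
  by (simp add: UA_UA0 UA0_NPhi)

lemma UA0_s: "v \<in> UA0 \<Longrightarrow> label_sum v = 0"
proof (induction rule: UA0.induct)
  case (step v i)
  show ?case by (simp add: label_sum_def sec_plus)
qed simp

text \<open>For \<^term>\<open>diag v\<close> in the group, \<open>PhiA_label_sum_sec\<close> forces \<open>label_sum v = label v\<close>, while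
  \<open>label_sum v\<close> vanishes because \<open>v\<close> has three equal sections.\<close>
lemma UA0_diag_PhiA: "v \<in> UA0 \<Longrightarrow> diag v \<in> PhiA \<Longrightarrow> v = 0"
proof (induction rule: UA0.induct)
  case (step v i)
  let ?v = "xp i + diag v"
  have "label_sum ?v = label ?v" using PhiA_label_sum_sec[OF step.prems, of 0] by simp
  moreover have "label_sum ?v = 0" using step by (intro UA0_s UA0.step)
  moreover have "label ?v = i" by (simp add: label_plus)
  ultimately have "i = 0" by simp
  moreover have "?v \<in> PhiA" using PhiA_sec[OF step.prems, of 0] by simp
  ultimately show ?case using step by simp
qed simp

lemma PhiA_UA: "f \<in> PhiA \<Longrightarrow> f \<in> UA \<Longrightarrow> f = 0"
  by (auto simp: UA_def dest: UA0_diag_PhiA)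

definition PhiU :: "aut set" where "PhiU = {f + u | f u. f \<in> PhiA \<and> u \<in> UA}"

lemma PhiU_I: "f \<in> PhiA \<Longrightarrow> u \<in> UA \<Longrightarrow> f + u \<in> PhiU"
  by (auto simp: PhiU_def)

lemma PhiA_PhiU: "f \<in> PhiA \<Longrightarrow> f \<in> PhiU" and UA_PhiU: "u \<in> UA \<Longrightarrow> u \<in> PhiU"
  using PhiU_I[of f 0] PhiU_I[of 0 u] by simp_all

lemma PhiU_NPhi: "g \<in> PhiU \<Longrightarrow> g \<in> NPhi"
  by (auto simp: PhiU_def intro: NPhi_plus PhiA_NPhi UA_NPhi)

lemma PhiU_plus: assumes "g \<in> PhiU" "h \<in> PhiU" shows "g + h \<in> PhiU"
proof -
  obtain f u f' u' where *: "g = f + u" "h = f' + u'" "f \<in> PhiA" "f' \<in> PhiA" "u \<in> UA" "u' \<in> UA"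
    using assms by (auto simp: PhiU_def)
  have "g + h = (f + cj (- u) f') + (u + u')"
    by (simp add: * cj_def add.assoc diff_conv_add_uminus del: add_uminus_conv_diff)
  moreover have "cj (- u) f' \<in> PhiA" using * by (simp add: NPhi_cj NPhi_uminus UA_NPhi)
  ultimately show ?thesis using * by (simp add: PhiU_I PhiA_plus UA_plus)
qed

text \<open>\<open>h\<close> strips \<open>g\<close> of its rotation and of the factor
  \<open>u\<close> in its section at \<open>y\<close>. By \<open>NPhi_sec_diff\<close> all sections
  of \<open>h\<close> then lie in the group, and the remaining defect is a diagonal power of
  \<open>X\<close>, which \<open>UA\<close> absorbs.\<close>

lemma PhiU_of_sec:
  assumes g: "g \<in> NPhi" and y: "sec g y \<in> PhiU" shows "g \<in> PhiU"
proof -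
  obtain f u where f: "f \<in> PhiA" and u: "u \<in> UA" and gy: "sec g y = f + u"
    using y by (auto simp: PhiU_def)
  define h where "h = diag (- u) + g + xp (- label g)"
  have "u \<in> NPhi" using u by (rule UA_NPhi)
  have hN: "h \<in> NPhi" using g \<open>u \<in> NPhi\<close> by (simp add: h_def NPhi_plus PhiA_NPhi NPhi_diag NPhi_uminus)
  have acth: "act h z = z" for z by (simp add: h_def act_rot[OF NPhi_rot[OF g]])
  have sech: "sec h z = - u + sec g z" for z by (simp add: h_def sec_plus)
  have hy: "sec h y \<in> PhiA"
    using NPhi_cj[OF \<open>u \<in> NPhi\<close> f] by (simp add: sech gy cj_def add.assoc)
  have st: "sec h (z + T1) \<in> PhiA" if "sec h z \<in> PhiA" for z
    using PhiA_plus[OF NPhi_sec_diff[OF hN, of z] that] by simp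
  have "sec h (y + i) \<in> PhiA" for i
    using hy st[OF hy] st[OF st[OF hy]] by (rule_tac tri_cases[of i]) (simp_all add: add.assoc)
  then have "sec h z \<in> PhiA" for z by (metis add_diff_cancel_left' diff_add_cancel add.commute)
  then obtain d where d: "diag (xp d) + h \<in> PhiA" using NPhi_sections_PhiA[OF hN acth] by blast
  have *: "diag u + diag (xp (- d)) \<in> UA"
    unfolding UA_def diag_plus[symmetric] using u by (intro imageI UA0_plus UA0_xp UA_UA0)
  have "g = (diag u + diag (xp (- d))) + (diag (xp d) + h) + xp (label g)"
    by (simp add: h_def add.assoc xp_uminus diag_uminus diff_conv_add_uminus del: add_uminus_conv_diff)
  then show ?thesis using d * by (metis PhiA_PhiU PhiA_gens(1) PhiA_pw UA_PhiU PhiU_plus)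
qed

text \<open>Commuting with \<open>X\<close> makes \<open>q\<close> a rotation with equal sections.
  Commuting with \<open>Gam\<close>, whose only trivial section is at \<open>T2\<close>, makes that
  rotation trivial. The common section again centralizes both generators, so induction on the word
  applies.\<close>

lemma centralizer_trivial:
  assumes "cj q X = X" "cj q Gam = Gam" shows "q = 0"
proof -
  have "Rep_aut q w = w" if "cj q X = X" "cj q Gam = Gam" for q w
    using that
  proof (induction w arbitrary: q)
    case (Cons y w)
    have X: "X + q = q + X" and Gam: "Gam + q = q + Gam"
      using Cons.prems by (simp_all add: cj_def add.assoc minus_equation_iff eq_neg_iff_add_eq_0)
        (metis add_minus_cancel)+
    have st: "act q (y + T1) = act q y + T1" for y
      using arg_cong[OF X, of "\<lambda>g. act g y"] by simp
    have "act q T1 = act q 0 + T1" using st[of 0] by simp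
    moreover from this have "act q T2 = act q 0 + T2" using st[of T1] by (simp add: add.assoc)
    ultimately have a: "act q y = y + label q" for y
      unfolding label_def by (rule_tac tri_cases[of y]) (simp_all add: add.commute)
    have "sec q (y + T1) = sec q y" for y
      using arg_cong[OF X, of "\<lambda>g. sec g y"] by (simp add: sec_plus)
    from this[of 0] this[of T1] have c: "sec q y = sec q 0" for y
      by (rule_tac tri_cases[of y]) simp_all
    have g: "sec Gam y + sec q 0 = sec q 0 + sec Gam (y + label q)" for y
      using arg_cong[OF Gam, of "\<lambda>g. sec g y"] by (simp add: sec_plus a c[of y])
    have "sec q 0 + sec Gam (T2 + label q) = sec q 0 + 0"
      unfolding g[of T2, symmetric] by (simp add: sec_Gam)
    then have "sec Gam (T2 + label q) = 0" by (simp only: add_left_cancel)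
    then have "label q = 0" by (rule_tac tri_cases[of "label q"]) (simp_all add: sec_Gam)
    then have "cj (sec q 0) X = X" "cj (sec q 0) Gam = Gam"
      using g[of 0] g[of T1] by (simp_all add: sec_Gam cj_def add.assoc)
    then have "Rep_aut (sec q y) w = w" using Cons.IH c[of y] by simp
    then show ?case by (simp add: Rep_aut_Cons a \<open>label q = 0\<close>)
  qed simp
  from this[OF assms] have "Rep_aut q = Rep_aut 0" by (simp add: fun_eq_iff zero_aut.rep_eq)
  then show ?thesis by (simp only: Rep_aut_inject)
qed

section \<open>Length and descent\<close>

text \<open>A pair \<open>(i, e)\<close> stands for the \<open>e\<close>-th power of \<open>\<gamma>\<^sub>i\<close>.\<close>

fun wordval :: "(tri \<times> tri) list \<Rightarrow> aut" where
  "wordval [] = 0"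
| "wordval ((i, e) # ws) = Gm i e + wordval ws"

text \<open>Letters may have exponent 0, so \<open>n\<close> is only an upper bound for the length;
  the final power of \<open>X\<close> costs nothing.\<close>

definition has_len :: "nat \<Rightarrow> aut \<Rightarrow> bool" where
  "has_len n f \<longleftrightarrow> (\<exists>ws k. length ws = n \<and> f = wordval ws + xp k)"

lemma wordval_append: "wordval (us @ ws) = wordval us + wordval ws"
  by (induction us rule: wordval.induct) (simp_all add: add.assoc)

lemma wordval_PhiA [simp]: "wordval ws \<in> PhiA"
  by (induction ws rule: wordval.induct) (simp_all add: PhiA_plus)

lemma act_wordval [simp]: "act (wordval ws) y = y"
  by (induction ws rule: wordval.induct) simp_all

lemma xp_Gm: "xp k + Gm i e = Gm (i - k) e + xp k"
proof -
  have "xp (- (i - k)) = xp k + xp (- i)" "xp (i - k) + xp k = xp i"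
    by (simp_all add: algebra_simps flip: xp_plus)
  then show ?thesis by (simp add: Gm_def add.assoc)
qed

lemma xp_wordval: "xp k + wordval ws = wordval (map (\<lambda>(i, e). (i - k, e)) ws) + xp k"
proof (induction ws rule: wordval.induct)
  case (2 i e ws)
  have "xp k + wordval ((i, e) # ws) = Gm (i - k) e + (xp k + wordval ws)"
    by (simp add: xp_Gm flip: add.assoc)
  then show ?case using 2 by (simp add: add.assoc)
qed simp

lemma has_len_plus: assumes "has_len n f" "has_len m g" shows "has_len (n + m) (f + g)"
proof -
  obtain us k ws l where "length us = n" "f = wordval us + xp k" "length ws = m" "g = wordval ws + xp l"
    using assms by (auto simp: has_len_def)
  moreover from this have "f + g = wordval us + (xp k + wordval ws) + xp l"
    by (simp add: add.assoc)
  ultimately show ?thesis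
    unfolding has_len_def xp_wordval by (intro exI[of _ "us @ map (\<lambda>(i, e). (i - k, e)) ws"] exI[of _ "k + l"])
      (simp add: wordval_append xp_plus add.assoc)
qed

lemma has_len_xp: "has_len 0 (xp k)" and has_len_Gm: "has_len 1 (Gm i e)"
proof -
  show "has_len 0 (xp k)" by (auto simp: has_len_def)
  show "has_len 1 (Gm i e)" unfolding has_len_def by (intro exI[of _ "[(i, e)]"] exI[of _ 0]) simp
qed

lemma Gm_uminus: "- Gm i e = Gm i (- e)"
  by (simp add: Gm_def minus_add xp_uminus gp_uminus add.assoc diff_conv_add_uminus del: add_uminus_conv_diff)

lemma has_len_gp: "has_len 1 (gp e)"
  using has_len_Gm[of 0 e] by (simp add: Gm_def)

lemma has_len_uminus: assumes "has_len n f" shows "has_len n (- f)"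
proof -
  obtain ws k where *: "length ws = n" "f = wordval ws + xp k" using assms by (auto simp: has_len_def)
  have "has_len (length ws) (- wordval ws)"
  proof (induction ws rule: wordval.induct)
    case 1
    show ?case using has_len_xp[of 0] by simp
  next
    case (2 i e ws)
    show ?case
      using has_len_plus[OF 2 has_len_Gm[of i "- e"]]
      by (simp add: minus_add Gm_uminus[symmetric] diff_conv_add_uminus del: add_uminus_conv_diff)
  qed
  from has_len_plus[OF has_len_xp[of "- k"] this] show ?thesis
    by (simp add: * minus_add xp_uminus)
qed

lemma has_len_PhiA: "f \<in> PhiA \<Longrightarrow> \<exists>n. has_len n f"
proof (induction rule: PhiA.induct)
  case zero
  show ?case using has_len_xp[of 0] by auto
next
  case (X_step f)
  then show ?case using has_len_plus[OF _ has_len_xp[of T1]] by auto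
next
  case (Gam_step f)
  then show ?case using has_len_plus[OF _ has_len_gp[of T1]] by auto
qed

definition gam_len :: "aut \<Rightarrow> nat" where "gam_len f = (LEAST n. has_len n f)"

lemma has_len_len: "f \<in> PhiA \<Longrightarrow> has_len (gam_len f) f"
  unfolding gam_len_def using has_len_PhiA by (rule LeastI_ex)

lemma gam_len_le: "has_len n f \<Longrightarrow> gam_len f \<le> n"
  unfolding gam_len_def by (rule Least_le)

lemma gam_len_plus: "f \<in> PhiA \<Longrightarrow> g \<in> PhiA \<Longrightarrow> gam_len (f + g) \<le> gam_len f + gam_len g"
  by (intro gam_len_le has_len_plus has_len_len)

lemma gam_len_uminus: "f \<in> PhiA \<Longrightarrow> gam_len (- f) \<le> gam_len f"
  by (intro gam_len_le has_len_uminus has_len_len)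

lemma gam_len_xp [simp]: "gam_len (xp k) = 0"
  using gam_len_le[OF has_len_xp[of k]] by simp

lemma gam_len_zero [simp]: "gam_len 0 = 0"
  using gam_len_xp[of 0] by simp

lemma gam_len_gp: "gam_len (gp e) \<le> 1"
  by (rule gam_len_le, rule has_len_gp)

lemma gam_len_eq_0: assumes "f \<in> PhiA" "gam_len f = 0" shows "f = xp (label f)"
proof -
  obtain k where "f = xp k" using has_len_len[OF assms(1)] assms(2) by (auto simp: has_len_def)
  then show ?thesis by simp
qed

lemma gam_len_cj: "f \<in> PhiA \<Longrightarrow> h \<in> PhiA \<Longrightarrow> gam_len (cj h f) \<le> gam_len f + 2 * gam_len h"
  using gam_len_plus[of "- h + f" h] gam_len_plus[of "- h" f] gam_len_uminus[of h]
  by (simp add: cj_def PhiA_plus PhiA_uminus)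

section \<open>Lengths of sections\<close>

definition letter_count :: "tri \<Rightarrow> (tri \<times> tri) list \<Rightarrow> nat" where
  "letter_count y ws = length (filter (\<lambda>(i, e). i = y) ws)"

lemma letter_count_simps [simp]: "letter_count y [] = 0" "letter_count y ((i, e) # ws) = (if i = y then Suc (letter_count y ws) else letter_count y ws)"
  by (simp_all add: letter_count_def)

lemma letter_count_sum: "letter_count 0 ws + letter_count T1 ws + letter_count T2 ws = length ws"
proof (induction ws rule: wordval.induct)
  case (2 i e ws)
  then show ?case by (rule_tac tri_cases[of i]) simp_all
qed simp

text \<open>A letter of index \<open>i\<close> adds at most 1 to the length at \<open>i\<close>; its
  section at \<open>i + T1\<close> is a power of \<open>X\<close>, of length 0.\<close>

lemma gam_len_sec_wordval: "gam_len (sec (wordval ws) y) \<le> letter_count y ws"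
proof (induction ws rule: wordval.induct)
  case (2 i e ws)
  have "gam_len (sec (Gm i e) y) \<le> (if i = y then 1 else 0)"
    using gam_len_gp[of e] by (auto simp: sec_Gm)
  moreover have "gam_len (sec (wordval ((i, e) # ws)) y) \<le> gam_len (sec (Gm i e) y) + gam_len (sec (wordval ws) y)"
    by (simp add: sec_plus gam_len_plus PhiA_sec)
  ultimately show ?case using 2 by (simp split: if_splits)
qed simp

lemma gam_len_word: assumes "f \<in> PhiA" obtains ws where "length ws = gam_len f" "f = wordval ws + xp (label f)"
proof -
  obtain ws k where *: "length ws = gam_len f" "f = wordval ws + xp k"
    using has_len_len[OF assms] by (auto simp: has_len_def)
  then have "label f = k" by (simp add: label_def)
  with * that show thesis by metis
qed

lemma gam_len_sec_sum:
  assumes "f \<in> PhiA" shows "gam_len (sec f 0) + gam_len (sec f T1) + gam_len (sec f T2) \<le> gam_len f"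
proof -
  obtain ws where ws: "length ws = gam_len f" "f = wordval ws + xp (label f)" using gam_len_word[OF assms] .
  have "sec f y = sec (wordval ws) y" for y by (subst ws(2)) (simp add: sec_plus)
  then show ?thesis
    using gam_len_sec_wordval[of ws 0] gam_len_sec_wordval[of ws T1] gam_len_sec_wordval[of ws T2] letter_count_sum[of ws] ws(1) by simp
qed

section \<open>The equality case: words in two conjugates of \<gamma>\<close>

lemma Gm_plus: "Gm i (a + b) = Gm i a + Gm i b"
proof -
  have "xp i + (xp (- i) + g) = g" for g by (simp add: xp_uminus)
  then show ?thesis by (simp add: Gm_def gp_plus add.assoc)
qed

lemma Gm_zero [simp]: "Gm i 0 = 0"
  by (simp add: Gm_def xp_uminus)

lemma wordval_T1: "letter_count T2 ws = 0 \<Longrightarrow> letter_count 0 ws = 0 \<Longrightarrow> \<exists>a. wordval ws = Gm T1 a"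
proof (induction ws rule: wordval.induct)
  case 1
  show ?case by (auto intro: exI[of _ 0])
next
  case (2 i e ws)
  then have i: "i = T1" by (rule_tac tri_cases[of i]) simp_all
  then obtain a where "wordval ws = Gm T1 a" using 2 by auto
  then show ?case using i by (auto simp flip: Gm_plus)
qed

lemma wordval_T1_0:
  "letter_count T2 ws = 0 \<Longrightarrow> letter_count 0 ws \<le> 1 \<Longrightarrow> \<exists>a e b. wordval ws = Gm T1 a + Gm 0 e + Gm T1 b"
proof (induction ws rule: wordval.induct)
  case 1
  show ?case by (rule exI[of _ 0], rule exI[of _ 0], rule exI[of _ 0]) simp
next
  case (2 i e ws)
  show ?case
  proof (cases "i = 0")
    case True
    then obtain b where "wordval ws = Gm T1 b" using 2 wordval_T1[of ws] by auto
    then show ?thesis using True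
      by (intro exI[of _ 0] exI[of _ e] exI[of _ b]) simp
  next
    case False
    then have i: "i = T1" using 2 by (rule_tac tri_cases[of i]) simp_all
    then obtain a e' b where "wordval ws = Gm T1 a + Gm 0 e' + Gm T1 b" using 2 by auto
    then show ?thesis using i
      by (intro exI[of _ "e + a"] exI[of _ e'] exI[of _ b]) (simp add: Gm_plus add.assoc)
  qed
qed

lemma sec_wordval_0: "letter_count T2 ws = 0 \<Longrightarrow> \<exists>e. sec (wordval ws) 0 = gp e"
proof (induction ws rule: wordval.induct)
  case 1
  show ?case by (auto intro: exI[of _ 0])
next
  case (2 i e ws)
  then obtain e' where e': "sec (wordval ws) 0 = gp e'" by (auto split: if_splits)
  have "i = 0 \<or> i = T1" using 2 by (rule_tac tri_cases[of i]) simp_all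
  then show ?case
    using e' by (auto simp: sec_plus sec_Gm simp flip: gp_plus)
qed

text \<open>Equality of lengths leaves no letter of index \<open>T2\<close> and makes the number of
  letters of index 0 the length of the section at 0. That section is a power of \<gamma>, so there
  is at most one such letter. The trivial section at \<open>T2\<close> makes the exponents of the
  letters of index \<open>T1\<close> cancel.\<close>

lemma rigid_word:
  assumes f: "f \<in> PhiA" "label f = 0" "sec f T2 = 0" and l: "gam_len f \<le> gam_len (sec f 0) + gam_len (sec f T1)"
  obtains a e where "f = Gm T1 a + Gm 0 e + Gm T1 (- a)"
proof -
  obtain ws where ws: "length ws = gam_len f" "f = wordval ws" using gam_len_word[OF f(1)] f(2) by auto
  have 1: "letter_count T2 ws = 0" "gam_len (sec f 0) = letter_count 0 ws"
    using letter_count_sum[of ws] gam_len_sec_wordval[of ws 0] gam_len_sec_wordval[of ws T1] l ws by auto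
  obtain e' where "sec f 0 = gp e'" using sec_wordval_0[OF 1(1)] ws by auto
  then have "letter_count 0 ws \<le> 1" using 1(2) gam_len_gp[of e'] by simp
  then obtain a e b where abc: "f = Gm T1 a + Gm 0 e + Gm T1 b"
    using wordval_T1_0[OF 1(1)] ws by auto
  have "sec f T2 = xp (a + b)" unfolding abc by (simp add: sec_plus sec_Gm xp_plus)
  then have "a + b = 0" using f(3) label_simps(4)[of "a + b"] by simp
  then have "b = - a" by (simp add: eq_neg_iff_add_eq_0 add.commute)
  then show thesis using abc that by blast
qed

definition conj_len :: "aut \<Rightarrow> nat" where "conj_len g = gam_len (cj g Gam) + gam_len (cj g X)"

lemma gam_len_cj_xp: "g \<in> NPhi \<Longrightarrow> f \<in> PhiA \<Longrightarrow> gam_len (cj (g + xp k) f) \<le> gam_len (cj g f)"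
  using gam_len_cj[of "cj g f" "xp k"] by (simp add: cj_plus_left NPhi_cj)

lemma sec_cj_Gam:
  assumes "\<And>y. act g y = y"
  shows "sec (cj g Gam) 0 = cj (sec g 0) Gam" "sec (cj g Gam) T1 = cj (sec g T1) X" "sec (cj g Gam) T2 = 0"
  using sec_cj[of g Gam 0] sec_cj[of g Gam T1] sec_cj[of g Gam T2] assms
  by (simp_all add: sec_Gam cj_def[of "sec g 0"] cj_def[of "sec g T1"])

lemma gam_len_cj_Gam_sec:
  assumes "g \<in> NPhi" "\<And>y. act g y = y"
  shows "gam_len (cj (sec g 0) Gam) + gam_len (cj (sec g T1) X) \<le> gam_len (cj g Gam)"
  using gam_len_sec_sum[OF NPhi_cj[OF assms(1), of Gam]] by (simp add: sec_cj_Gam[OF assms(2)])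

text \<open>The sections \<open>\<phi>\<close> of \<open>x\<^sup>g\<close> have product 1, so each is at most as long as the other two together,
  and twice its length is at most \<open>\<ell>(x\<^sup>g)\<close>; conjugation by \<open>\<phi> 0\<close> relates the two sections of \<open>g\<close>.\<close>

lemma conj_len_sec:
  assumes g: "g \<in> NPhi" and a: "\<And>y. act g y = y"
  shows "conj_len (sec g 0) \<le> conj_len g" "conj_len (sec g T1) \<le> conj_len g"
proof -
  define \<phi> where "\<phi> z = sec (cj g X) z" for z
  have \<phi>: "\<phi> z = - sec g z + sec g (z + T1)" for z
    using sec_cj[of g X z] a by (simp add: \<phi>_def)
  have P: "\<phi> z \<in> PhiA" for z using g by (simp add: \<phi>_def NPhi_cj PhiA_sec)
  have "\<phi> 0 = - (\<phi> T1 + \<phi> T2)"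
    by (simp add: \<phi> minus_add add.assoc diff_conv_add_uminus del: add_uminus_conv_diff)
  then have "gam_len (\<phi> 0) \<le> gam_len (\<phi> T1) + gam_len (\<phi> T2)"
    using gam_len_uminus[of "\<phi> T1 + \<phi> T2"] gam_len_plus[of "\<phi> T1" "\<phi> T2"] P by (simp add: PhiA_plus)
  then have 1: "2 * gam_len (\<phi> 0) \<le> gam_len (cj g X)"
    using gam_len_sec_sum[of "cj g X"] g by (simp add: NPhi_cj flip: \<phi>_def)
  have s1: "sec g T1 = sec g 0 + \<phi> 0" and s0: "sec g 0 = sec g T1 + - \<phi> 0"
    by (simp_all add: \<phi> minus_add add.assoc diff_conv_add_uminus del: add_uminus_conv_diff)
  have secN: "sec g z \<in> NPhi" for z using g by (rule NPhi_sec)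
  have "gam_len (cj (sec g T1) Gam) \<le> gam_len (cj (sec g 0) Gam) + 2 * gam_len (\<phi> 0)"
    unfolding s1 cj_plus_left using secN P by (intro gam_len_cj NPhi_cj) simp_all
  moreover have "gam_len (cj (sec g 0) X) \<le> gam_len (cj (sec g T1) X) + 2 * gam_len (- \<phi> 0)"
    by (subst s0, subst cj_plus_left, intro gam_len_cj NPhi_cj) (simp_all add: secN P PhiA_uminus)
  ultimately show "conj_len (sec g 0) \<le> conj_len g" "conj_len (sec g T1) \<le> conj_len g"
    using gam_len_cj_Gam_sec[OF g a] gam_len_uminus[OF P, of 0] 1 by (simp_all add: conj_len_def)
qed

text \<open>Take a counterexample minimal for \<open>conj_len\<close>, then for the length of the
  conjugate of \<open>Gam\<close>. Removing rotations costs no length, and sections of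
  counterexamples are counterexamples by \<open>PhiU_of_sec\<close>.\<close>

theorem NPhi_eq_PhiU: "NPhi = PhiU"
proof (rule ccontr)
  define B where "B = NPhi - PhiU"
  assume "NPhi \<noteq> PhiU"
  then obtain g0 where "g0 \<in> B" using PhiU_NPhi by (auto simp: B_def)
  have B_xp: "g + xp k \<in> B" if "g \<in> B" for g k
  proof -
    have "g + xp k + xp (- k) = g" by (simp add: add.assoc xp_uminus)
    then show ?thesis
      using that PhiU_plus[OF _ PhiA_PhiU, of "g + xp k" "xp (- k)"] by (auto simp: B_def NPhi_plus PhiA_NPhi)
  qed
  have B_sec: "sec g y \<in> B" if "g \<in> B" for g y
    using that by (auto simp: B_def NPhi_sec dest: PhiU_of_sec)
  have norm: "\<exists>h\<in>B. (\<forall>y. act h y = y) \<and> gam_len (cj h Gam) \<le> gam_len (cj g Gam) \<and> gam_len (cj h X) \<le> gam_len (cj g X)"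
    if "g \<in> B" for g
  proof (intro bexI[of _ "g + xp (- label g)"] conjI allI)
    show "g + xp (- label g) \<in> B" using that by (rule B_xp)
    have "g \<in> NPhi" using that by (simp add: B_def)
    then show "act (g + xp (- label g)) y = y" for y by (simp add: act_rot NPhi_rot)
    show "gam_len (cj (g + xp (- label g)) Gam) \<le> gam_len (cj g Gam)" "gam_len (cj (g + xp (- label g)) X) \<le> gam_len (cj g X)"
      using \<open>g \<in> NPhi\<close> by (simp_all add: gam_len_cj_xp)
  qed
  obtain m where m: "m \<in> B" "\<And>g. g \<in> B \<Longrightarrow> conj_len m \<le> conj_len g"
    using ex_has_least_nat[of "\<lambda>g. g \<in> B" g0 conj_len] \<open>g0 \<in> B\<close> by blast
  obtain g1 where g1: "g1 \<in> B" "conj_len g1 = conj_len m"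
    "\<And>g. g \<in> B \<Longrightarrow> conj_len g = conj_len m \<Longrightarrow> gam_len (cj g1 Gam) \<le> gam_len (cj g Gam)"
    using ex_has_least_nat[of "\<lambda>g. g \<in> B \<and> conj_len g = conj_len m" m "\<lambda>g. gam_len (cj g Gam)"] m(1) by blast
  obtain g where g: "g \<in> B" "\<And>y. act g y = y" "gam_len (cj g Gam) \<le> gam_len (cj g1 Gam)" "gam_len (cj g X) \<le> gam_len (cj g1 X)"
    using norm[OF g1(1)] by blast
  have gN: "g \<in> NPhi" using g(1) by (simp add: B_def)
  have Lg: "conj_len g = conj_len m" using m(2)[OF g(1)] g(3,4) g1(2) by (simp add: conj_len_def)
  have L0: "conj_len (sec g 0) = conj_len m" "conj_len (sec g T1) = conj_len m"
    using conj_len_sec[OF gN g(2)] m(2)[OF B_sec[OF g(1)]] Lg by (simp_all add: antisym)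
  \<comment> \<open>\<open>sec g 0\<close> also attains the minimum of \<open>conj_len\<close>, so
    its conjugate of \<open>Gam\<close> is at least as long as that of \<open>g\<close>; nothing is
    left for the other summand.\<close>
  have X0: "gam_len (cj (sec g T1) X) = 0"
    using g1(3)[OF B_sec[OF g(1)] L0(1)] g(3) gam_len_cj_Gam_sec[OF gN g(2)] by simp
  obtain p where p: "p \<in> B" "\<And>y. act p y = y" "gam_len (cj p Gam) \<le> gam_len (cj (sec g T1) Gam)" "gam_len (cj p X) = 0"
    using norm[OF B_sec[OF g(1), of T1]] X0 by auto
  have pN: "p \<in> NPhi" using p(1) by (simp add: B_def)
  \<comment> \<open>Length 0 leaves a power of \<open>X\<close>, and conjugation preserves the label
    \<open>T1\<close>.\<close>
  have pX: "cj p X = X"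
    using gam_len_eq_0[OF NPhi_cj[OF pN] p(4)] NPhi_label[OF pN, of X] by simp
  have sp: "sec p (z + T1) = sec p z" for z
  proof -
    have "- sec p z + sec p (z + T1) = 0" using sec_cj[of p X z] pX p(2) by simp
    then have "sec p z + (- sec p z + sec p (z + T1)) = sec p z" by simp
    then show ?thesis by simp
  qed
  define q where "q = sec p 0"
  have sp1: "sec p T1 = q" using sp[of 0] by (simp add: q_def)
  have qB: "q \<in> B" using p(1) by (simp add: q_def B_sec)
  then have qN: "q \<in> NPhi" by (simp add: B_def)
  note sc = sec_cj_Gam[OF p(2), unfolded sp1 q_def[symmetric]]
  \<comment> \<open>The left side is at most \<open>conj_len m\<close>, and the right side is
    \<open>conj_len q\<close>, which is at least that. This is the equality case for
    \<open>rigid_word\<close>.\<close>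
  have "gam_len (cj p Gam) \<le> gam_len (cj q Gam) + gam_len (cj q X)"
    using m(2)[OF qB] p(3) L0(2) by (simp add: conj_len_def)
  then have *: "gam_len (cj p Gam) \<le> gam_len (sec (cj p Gam) 0) + gam_len (sec (cj p Gam) T1)"
    by (simp add: sc)
  have "label (cj p Gam) = 0" using NPhi_label[OF pN, of Gam] by simp
  then obtain a e where ae: "cj p Gam = Gm T1 a + Gm 0 e + Gm T1 (- a)"
    using rigid_word[OF NPhi_cj[OF pN PhiA_gens(2)] _ sc(3) *] by blast
  have "cj q Gam = gp e"
    using sc(1) unfolding ae by (simp add: sec_plus sec_Gm)
  moreover from this have "e = T1" using NPhi_label_sum[OF qN, of Gam] by simp
  ultimately have qG: "cj q Gam = Gam" by simp
  have qX: "cj q X = gp a + X - gp a"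
    using sc(2) unfolding ae \<open>e = T1\<close> by (simp add: sec_plus sec_Gm gp_uminus)
  \<comment> \<open>The factor \<open>gp a\<close> undoes the conjugation in \<open>qX\<close> and
    commutes with \<open>Gam\<close>.\<close>
  have "cj (q + gp a) X = X"
    unfolding cj_plus_left qX by (simp add: cj_def add.assoc)
  moreover have "cj (q + gp a) Gam = Gam"
    unfolding cj_plus_left qG
    by (rule tri_cases[of a]) (simp_all add: cj_def pw_T2 add.assoc minus_add diff_conv_add_uminus del: add_uminus_conv_diff)
  ultimately have "q + gp a = 0" by (rule centralizer_trivial)
  then have "q = gp (- a)" by (simp add: eq_neg_iff_add_eq_0 gp_uminus)
  then have "q \<in> PhiU" by (simp add: PhiA_PhiU)
  then show False using qB by (simp add: B_def)
qed

section \<open>Transfer to words\<close>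

lemma W_Rep: "carrier W = range Rep_aut" "\<one>\<^bsub>W\<^esub> = Rep_aut 0" "Rep_aut g \<otimes>\<^bsub>W\<^esub> Rep_aut h = Rep_aut (g + h)"
  using type_definition.Rep_range[OF type_definition_aut]
  by (simp_all add: W_def zero_aut.rep_eq plus_aut.rep_eq)

lemma inj_Rep: "inj Rep_aut"
  by (simp add: inj_def Rep_aut_inject)

lemma group_W: "group W"
proof (rule groupI)
  fix x assume "x \<in> carrier W"
  then obtain g where "x = Rep_aut g" by (auto simp: W_Rep)
  then have "Rep_aut (- g) \<otimes>\<^bsub>W\<^esub> x = \<one>\<^bsub>W\<^esub>" by (simp only: W_Rep left_minus)
  then show "\<exists>y\<in>carrier W. y \<otimes>\<^bsub>W\<^esub> x = \<one>\<^bsub>W\<^esub>" by (auto simp: W_Rep(1))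
qed (auto simp: W_Rep add.assoc)

lemma inv_W_Rep: "inv\<^bsub>W\<^esub> (Rep_aut g) = Rep_aut (- g)"
  by (rule group.inv_equality[OF group_W]) (simp_all add: W_Rep)

lemma Phi_Rep: "Phi = Rep_aut ` PhiA"
proof
  show "Phi \<subseteq> Rep_aut ` PhiA"
  proof
    fix f assume "f \<in> Phi"
    then show "f \<in> Rep_aut ` PhiA"
      unfolding Phi_def
    proof (induction rule: generate.induct)
      case one
      show ?case by (auto simp: W_Rep)
    next
      case (incl h)
      then show ?case by (auto simp flip: X.rep_eq Gam.rep_eq)
    next
      case (inv h)
      then show ?case by (auto simp: inv_W_Rep PhiA_uminus simp flip: X.rep_eq Gam.rep_eq)
    next
      case (eng h1 h2)
      then show ?case by (auto simp: W_Rep PhiA_plus)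
    qed
  qed
  have "Rep_aut f \<in> Phi" if "f \<in> PhiA" for f
    using that
  proof (induction rule: PhiA.induct)
    case zero
    show ?case unfolding Phi_def using generate.one[of W] by (simp only: W_Rep)
  next
    case (X_step f)
    show ?case
      using X_step.IH unfolding Phi_def W_Rep(3)[symmetric]
      by (rule generate.eng) (auto intro: generate.incl simp: X.rep_eq)
  next
    case (Gam_step f)
    show ?case
      using Gam_step.IH unfolding Phi_def W_Rep(3)[symmetric]
      by (rule generate.eng) (auto intro: generate.incl simp: Gam.rep_eq)
  qed
  then show "Rep_aut ` PhiA \<subseteq> Phi" by auto
qed

lemma Delta_pow_Rep: "(Delta ^^ n) (Rep_aut v) = Rep_aut ((diag ^^ n) v)"
  by (induction n) (simp_all add: Rep_diag)

lemma UA0_diag_pow: "v \<in> UA0 \<Longrightarrow> (diag ^^ n) v \<in> UA0"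
  by (induction n) (simp_all add: UA0_diag)

lemma diag_pow_UA: "n \<ge> 1 \<Longrightarrow> (diag ^^ n) X \<in> UA"
  using UA0_xp[of T1] UA0_diag_pow[of X "n - 1"] by (cases n) (auto simp: UA_def)

lemma U_Rep: "U = Rep_aut ` UA"
proof
  let ?S = "{(Delta ^^ n) xx | n. n \<ge> 1}"
  have S: "\<exists>u\<in>UA. h = Rep_aut u" if "h \<in> ?S" for h
    using that Delta_pow_Rep[of _ X] diag_pow_UA by (auto simp: X.rep_eq)
  show "U \<subseteq> Rep_aut ` UA"
  proof
    fix f assume "f \<in> U"
    then show "f \<in> Rep_aut ` UA"
      unfolding U_def
    proof (induction rule: generate.induct)
      case one
      show ?case by (auto simp: W_Rep)
    next
      case (incl h)
      then show ?case using S by blast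
    next
      case (inv h)
      then obtain u where "u \<in> UA" "h = Rep_aut u" using S by blast
      then show ?case by (auto simp: inv_W_Rep UA_uminus)
    next
      case (eng h1 h2)
      then show ?case by (auto simp: W_Rep UA_plus)
    qed
  qed
  have add: "Rep_aut (a + b) \<in> U" if "Rep_aut a \<in> U" "Rep_aut b \<in> U" for a b
    using that unfolding U_def W_Rep(3)[symmetric] by (rule generate.eng)
  have zeroU: "Rep_aut 0 \<in> U" unfolding U_def using generate.one[of W] by (simp only: W_Rep)
  have DX: "Rep_aut ((diag ^^ Suc n) X) \<in> U" for n
    unfolding U_def Delta_pow_Rep[symmetric] X.rep_eq
    by (rule generate.incl) (auto simp del: funpow.simps intro!: exI[of _ "Suc n"])
  have pow: "(diag ^^ n) (g + h) = (diag ^^ n) g + (diag ^^ n) h" "(diag ^^ n) 0 = 0" for n g h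
    by (induction n) (simp_all add: diag_plus)
  have xpU: "Rep_aut ((diag ^^ Suc n) (xp i)) \<in> U" for n i
    by (rule tri_cases[of i]) (simp_all only: pw_simps pw_T2 pow zeroU DX add)
  \<comment> \<open>For all \<open>n\<close> at once, since the induction trades a layer of
    \<open>v\<close> for one more \<open>diag\<close>.\<close>
  have "Rep_aut ((diag ^^ Suc n) v) \<in> U" if "v \<in> UA0" for v n
    using that
  proof (induction arbitrary: n rule: UA0.induct)
    case zero
    show ?case by (simp only: pow zeroU)
  next
    case (step v i)
    have "(diag ^^ Suc n) (diag v) = (diag ^^ Suc (Suc n)) v" by (simp only: funpow_Suc_right[of "Suc n"] o_apply)
    then show ?case using step by (simp only: pow add xpU)
  qed
  from this[of _ 0] show "Rep_aut ` UA \<subseteq> U" by (auto simp: UA_def)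
qed

text \<open>The cosets form g S g^(-1), whereas \<open>cj g\<close> has the inverse on the left;
  hence the sign.\<close>

lemma conj_coset_Rep:
  "Rep_aut g <#\<^bsub>W\<^esub> (Rep_aut ` S) #>\<^bsub>W\<^esub> inv\<^bsub>W\<^esub> (Rep_aut g) = Rep_aut ` cj (- g) ` S"
  by (auto simp: l_coset_def r_coset_def inv_W_Rep W_Rep cj_def)

lemma cj_image_eq_iff: "cj (- g) ` PhiA = PhiA \<longleftrightarrow> g \<in> NPhi"
proof
  assume eq: "cj (- g) ` PhiA = PhiA"
  have "cj g f \<in> PhiA \<and> cj (- g) f \<in> PhiA" if f: "f \<in> PhiA" for f
  proof
    obtain f' where "f' \<in> PhiA" "f = cj (- g) f'" using f eq by blast
    then show "cj g f \<in> PhiA" by simp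
    show "cj (- g) f \<in> PhiA" using f eq by blast
  qed
  then show "g \<in> NPhi" by (simp add: NPhi_def)
next
  assume g: "g \<in> NPhi"
  show "cj (- g) ` PhiA = PhiA"
  proof
    show "cj (- g) ` PhiA \<subseteq> PhiA" using g by (auto simp: NPhi_def)
    show "PhiA \<subseteq> cj (- g) ` PhiA"
    proof
      fix f assume "f \<in> PhiA"
      then have "f = cj (- g) (cj g f)" "cj g f \<in> PhiA" using g by (simp_all add: NPhi_cj)
      then show "f \<in> cj (- g) ` PhiA" by blast
    qed
  qed
qed

lemma normalizer_Rep: "normalizer W Phi = Rep_aut ` NPhi"
proof -
  have sub: "Phi \<subseteq> carrier W" by (auto simp: Phi_Rep W_Rep)
  have "normalizer W Phi = {x \<in> carrier W. x <#\<^bsub>W\<^esub> Phi #>\<^bsub>W\<^esub> inv\<^bsub>W\<^esub> x = Phi}"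
    using sub by (auto simp: normalizer_def stabilizer_def)
  also have "\<dots> = Rep_aut ` {g. cj (- g) ` PhiA = PhiA}"
    unfolding W_Rep(1)
    by (auto simp: Phi_Rep conj_coset_Rep inj_image_eq_iff[OF inj_Rep])
  finally show ?thesis by (simp add: cj_image_eq_iff)
qed

lemma countable_UA0: "countable UA0"
proof -
  \<comment> \<open>\<open>E n\<close> collects what \<open>n\<close> construction steps reach; each
    stage is finite because there are three letters.\<close>
  define E where "E n = ((\<lambda>S. (\<lambda>(i, v). xp i + diag v) ` (UNIV \<times> S)) ^^ n) {0}" for n :: nat
  have "(UNIV :: tri set) = {T0, T1, T2}" by (auto intro: tri.exhaust)
  then have "finite (UNIV :: tri set)" by (metis finite.emptyI finite.insertI)
  then have "finite (E n)" for n by (induction n) (simp_all add: E_def)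
  moreover have "UA0 \<subseteq> (\<Union>n. E n)"
  proof
    fix v assume "v \<in> UA0"
    then show "v \<in> (\<Union>n. E n)"
    proof (induction rule: UA0.induct)
      case zero
      have "0 \<in> E 0" by (simp add: E_def)
      then show ?case by blast
    next
      case (step v i)
      then obtain n where "v \<in> E n" by blast
      then have "xp i + diag v \<in> E (Suc n)" by (auto simp: E_def intro!: image_eqI[of _ _ "(i, v)"])
      then show ?case by blast
    qed
  qed
  ultimately show ?thesis
    by (meson countable_UN countable_finite countable_subset countableI_type)
qed

text \<open>\<open>X\<close> moves the first level and diagonal elements do not, so layers can be
  peeled off both sides until one of them is \<open>X\<close>.\<close>

lemma diag_pow_inj: "inj (\<lambda>n. (diag ^^ Suc n) X)"
proof (rule injI)
  have X: "X \<noteq> diag g" for g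
    using label_simps(2,6) T_neq(1) by metis
  have "(diag ^^ m) X = (diag ^^ n) X \<Longrightarrow> m = n" for m n
  proof (induction m arbitrary: n)
    case 0
    then show ?case using X by (cases n) auto
  next
    case (Suc m)
    then show ?case using X[symmetric] by (cases n) (auto simp: diag_inj)
  qed
  then show "(diag ^^ Suc m) X = (diag ^^ Suc n) X \<Longrightarrow> m = n" for m n by blast
qed

theorem theorem5p14:
  shows "subgroup U W
     \<and> (\<forall>a\<in>U. \<forall>b\<in>U. a \<otimes>\<^bsub>W\<^esub> b = b \<otimes>\<^bsub>W\<^esub> a)
     \<and> (\<forall>a\<in>U. a [^]\<^bsub>W\<^esub> (3::nat) = \<one>\<^bsub>W\<^esub>)
     \<and> infinite U \<and> countable U
     \<and> normalizer W Phi = Phi <#>\<^bsub>W\<^esub> U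
     \<and> Phi \<inter> U = {\<one>\<^bsub>W\<^esub>}"
proof (intro conjI ballI)
  interpret W: group W by (rule group_W)
  show "subgroup U W"
    unfolding U_def
  proof (rule W.generate_is_subgroup)
    show "{(Delta ^^ n) xx |n. n \<ge> 1} \<subseteq> carrier W"
      using Delta_pow_Rep[of _ X] by (auto simp: X.rep_eq W_Rep(1))
  qed
  show "a \<otimes>\<^bsub>W\<^esub> b = b \<otimes>\<^bsub>W\<^esub> a" if "a \<in> U" "b \<in> U" for a b
    using that by (auto simp: U_Rep W_Rep Rep_aut_inject UA0_commute UA_UA0)
  show "a [^]\<^bsub>W\<^esub> (3::nat) = \<one>\<^bsub>W\<^esub>" if a: "a \<in> U" for a
  proof -
    obtain u where u: "u \<in> UA" "a = Rep_aut u" using a by (auto simp: U_Rep)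
    then have "a [^]\<^bsub>W\<^esub> (3::nat) = Rep_aut (u + u + u)"
      by (simp add: numeral_3_eq_3 W.nat_pow_Suc W_Rep)
    then show ?thesis using UA0_triple[OF UA_UA0[OF u(1)]] by (simp add: W_Rep(2))
  qed
  show "infinite U"
  proof
    assume "finite U"
    moreover have "(\<lambda>n. Rep_aut ((diag ^^ Suc n) X)) ` UNIV \<subseteq> U"
      using diag_pow_UA by (auto simp: U_Rep simp del: funpow.simps)
    moreover have "inj (\<lambda>n. Rep_aut ((diag ^^ Suc n) X))"
      using diag_pow_inj by (simp add: inj_def Rep_aut_inject)
    ultimately show False by (meson finite_imageD finite_subset infinite_UNIV_nat)
  qed
  show "countable U" by (simp add: U_Rep UA_def countable_UA0)
  have "normalizer W Phi = Rep_aut ` PhiU" by (simp add: normalizer_Rep NPhi_eq_PhiU)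
  then show "normalizer W Phi = Phi <#>\<^bsub>W\<^esub> U"
    by (auto simp: Phi_Rep U_Rep PhiU_def set_mult_def W_Rep)
  show "Phi \<inter> U = {\<one>\<^bsub>W\<^esub>}"
    using PhiA_UA by (auto simp: Phi_Rep U_Rep W_Rep(2) Rep_aut_inject)
qed

end
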